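(* Let $K$ be a compact line. If the set of internal points of $K$ that have countable right character and do not have a separable adjacency in $K$ can be covered by countably many sets of finite two-sided height in $K$, then $K$ is separably determined.
   Context: A compact line is a totally ordered set which is compact in its order topology. A point $t\in K$ is right-isolated (resp. left-isolated) if $t=\max K$ (resp. $t=\min K$) or there is $s>t$ with $]t,s[=\emptyset$ (resp. $s<t$ with $]s,t[=\emptyset$); internal points are those neither right- nor left-isolated. For a closed subset $H$, $H^+$ is the set of right-isolated points of $H$ in its induced order. The right character of $t$ is $\omega$ if $t$ is right-isolated, and otherwise the least cardinality of a subset $A\subseteq\,]t,\max K]$ with $\inf A=t$. A point $t$ has a separable adjacency in $K$ if it belongs to a separable convex subset of $K$ with more than one point. For $A\subseteq K$, a point $t\in A$ is internal to $A$ relative to $K$ if $t\ne\min K,\max K$ and for all $s_1<t<s_2$ in $K$ both $]s_1,t[\cap A$ and $]t,s_2[\cap A$ are nonempty; $\mathrm{Der}(A,K)$ is the set of such points, $\mathrm{Der}_0(A,K)=A$, $\mathrm{Der}_{n+1}(A,K)=\mathrm{Der}(\mathrm{Der}_n(A,K),K)$, and $A$ has finite two-sided height in $K$ if $\mathrm{Der}_n(A,K)=\emptyset$ for some $n$. $\mathrm{NBV}(K)$ is the space of right-continuous real maps of bounded variation on $K$, identified with $C(K)^*$ via $F_\mu(t)=\mu([\min K,t])$; $\lim_{i\in I}a_i=0$ means $\{i:|a_i|\ge\varepsilon\}$ finite for all $\varepsilon>0$, $c_0(I)$ the set of such families; $(F_i)_{i\in I}$ is weak*-null if $\lim_i\int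 f\,d\mu_i=0$ for all $f\in C(K)$. $(F_i)$ is of type $c_0\ell_1$ over $Q$ if $F_i(t)=a_{i,t}+b_{i,t}$ with $\lim_ia_{i,t}=0$ for each $t\in Q$ and $\sup_i\sum_{t\in Q}|b_{i,t}|<\infty$. $K$ is separably determined if for every weak*-null family $(F_i)_{i\in I}$ in $\mathrm{NBV}(K)$ and every $Q\subseteq K$: whenever $\{t\in Q\cap(H\setminus H^+):(F_i(t))_{i\in I}\notin c_0(I)\}$ is countable for every closed separable $H\subseteq K$, the family is of type $c_0\ell_1$ over $Q$. *)

theory Defs
  imports "HOL-Probability.Probability"
begin

text \<open>The compact line K is the whole carrier of a type 'a of class linorder_topology
  (order topology) with compact UNIV.  Index sets of families are subsets of an
  arbitrary type 'i.\<close>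

definition is_max_pt :: "'a::linorder \<Rightarrow> bool" where
  "is_max_pt t \<longleftrightarrow> (\<forall>s. s \<le> t)"

definition is_min_pt :: "'a::linorder \<Rightarrow> bool" where
  "is_min_pt t \<longleftrightarrow> (\<forall>s. t \<le> s)"

definition right_isolated :: "'a::linorder \<Rightarrow> bool" where
  "right_isolated t \<longleftrightarrow> is_max_pt t \<or> (\<exists>s. t < s \<and> {t<..<s} = {})"

definition left_isolated :: "'a::linorder \<Rightarrow> bool" where
  "left_isolated t \<longleftrightarrow> is_min_pt t \<or> (\<exists>s. s < t \<and> {s<..<t} = {})"

definition internal_pt :: "'a::linorder \<Rightarrow> bool" where
  "internal_pt t \<longleftrightarrow> \<not> right_isolated t \<and> \<not> left_isolated t"

definition right_isolated_in :: "'a::linorder set \<Rightarrow> 'a set" where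
  "right_isolated_in H = {t \<in> H. (\<forall>s\<in>H. s \<le> t) \<or> (\<exists>s\<in>H. t < s \<and> {t<..<s} \<inter> H = {})}"

definition is_glb :: "'a::linorder set \<Rightarrow> 'a \<Rightarrow> bool" where
  "is_glb A t \<longleftrightarrow> (\<forall>a\<in>A. t \<le> a) \<and> (\<forall>u. (\<forall>a\<in>A. u \<le> a) \<longrightarrow> u \<le> t)"

definition countable_right_char :: "'a::linorder \<Rightarrow> bool" where
  "countable_right_char t \<longleftrightarrow>
     right_isolated t \<or> (\<exists>A. countable A \<and> A \<subseteq> {t<..} \<and> is_glb A t)"

definition separable_set :: "'a::topological_space set \<Rightarrow> bool" where
  "separable_set C \<longleftrightarrow> (\<exists>D. D \<subseteq> C \<and> countable D \<and> C \<subseteq> closure D)"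

definition order_convex :: "'a::linorder set \<Rightarrow> bool" where
  "order_convex C \<longleftrightarrow> (\<forall>x\<in>C. \<forall>y\<in>C. {x..y} \<subseteq> C)"

definition separable_adjacency :: "'a::linorder_topology \<Rightarrow> bool" where
  "separable_adjacency t \<longleftrightarrow>
     (\<exists>C. t \<in> C \<and> separable_set C \<and> order_convex C \<and> (\<exists>x\<in>C. \<exists>y\<in>C. x \<noteq> y))"

definition Der :: "'a::linorder set \<Rightarrow> 'a set" where
  "Der A = {t \<in> A. \<not> is_min_pt t \<and> \<not> is_max_pt t \<and>
      (\<forall>s1 s2. s1 < t \<and> t < s2 \<longrightarrow> {s1<..<t} \<inter> A \<noteq> {} \<and> {t<..<s2} \<inter> A \<noteq> {})}"

definition finite_two_sided_height :: "'a::linorder set \<Rightarrow> bool" where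
  "finite_two_sided_height A \<longleftrightarrow> (\<exists>n. (Der ^^ n) A = {})"

definition c0_family :: "'i set \<Rightarrow> ('i \<Rightarrow> real) \<Rightarrow> bool" where
  "c0_family I a \<longleftrightarrow> (\<forall>\<epsilon>>0. finite {i \<in> I. \<epsilon> \<le> \<bar>a i\<bar>})"

definition finite_radon :: "'a::topological_space measure \<Rightarrow> bool" where
  "finite_radon M \<longleftrightarrow> finite_measure M \<and> sets M = sets borel \<and>
     (\<forall>A\<in>sets borel. emeasure M A = (SUP C\<in>{C. compact C \<and> C \<subseteq> A}. emeasure M C))"

text \<open>Weak*-null family in NBV(K) = C(K)^*: each F_i is F_mu for the signed Radon measure
  mu_i = M1_i - M2_i, i.e. F_i(t) = mu_i([min K, t]), and integrals of continuous
  functions tend to 0 along I.\<close>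
definition weak_star_null :: "'i set \<Rightarrow> ('i \<Rightarrow> 'a::linorder_topology \<Rightarrow> real) \<Rightarrow> bool" where
  "weak_star_null I F \<longleftrightarrow>
     (\<exists>M1 M2. (\<forall>i\<in>I. finite_radon (M1 i) \<and> finite_radon (M2 i) \<and>
                 (\<forall>t. F i t = measure (M1 i) {..t} - measure (M2 i) {..t})) \<and>
              (\<forall>f::'a \<Rightarrow> real. continuous_on UNIV f \<longrightarrow>
                 c0_family I (\<lambda>i. integral\<^sup>L (M1 i) f - integral\<^sup>L (M2 i) f)))"

definition type_c0l1 :: "'i set \<Rightarrow> ('i \<Rightarrow> 'a \<Rightarrow> real) \<Rightarrow> 'a set \<Rightarrow> bool" where
  "type_c0l1 I F Q \<longleftrightarrow>
     (\<exists>a b. (\<forall>i\<in>I. \<forall>t\<in>Q. F i t = a i t + b i t) \<and>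
            (\<forall>t\<in>Q. c0_family I (\<lambda>i. a i t)) \<and>
            (\<exists>C. \<forall>i\<in>I. \<forall>Q0. Q0 \<subseteq> Q \<and> finite Q0 \<longrightarrow> (\<Sum>t\<in>Q0. \<bar>b i t\<bar>) \<le> C))"

text \<open>Separably determined, for families indexed by subsets of the type 'i
  (the theorem is polymorphic in 'i, so all index sets are covered).\<close>
definition separably_determined :: "'i itself \<Rightarrow> 'a::linorder_topology itself \<Rightarrow> bool" where
  "separably_determined _ _ \<longleftrightarrow>
     (\<forall>(I::'i set) (F::'i \<Rightarrow> 'a \<Rightarrow> real) (Q::'a set).
        weak_star_null I F \<longrightarrow>
        (\<forall>H. closed H \<and> separable_set H \<longrightarrow>
           countable {t \<in> Q \<inter> (H - right_isolated_in H). \<not> c0_family I (\<lambda>i. F i t)}) \<longrightarrow>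
        type_c0l1 I F Q)"

end

theory Submission
  imports Defs
begin

text \<open>
  Only the points \<open>t\<close> of \<open>Q\<close> at which the family is not null matter; they are not right-isolated
  and have countable right character, hence \<open>F i t = 0\<close> for all but countably many \<open>i\<close>. Two
  mechanisms bound the part \<open>b\<close> of a decomposition \<open>F i t = a + b\<close>. First, if \<open>f\<close> is a continuous
  step from \<open>1\<close> to \<open>0\<close> across an interval \<open>U t\<close> adjacent to \<open>t\<close>, then \<open>F i t\<close> differs from the null
  family \<open>\<integral> f d\<mu> i\<close> by at most the variation of \<open>\<mu> i\<close> on \<open>U t\<close>; so if the \<open>U t\<close> are disjoint, for
  each \<open>i\<close> only countably many \<open>t\<close> see a difference. This applies to left-isolated points, to sets
  of finite two-sided height, and, with one correction at the lower end, to the classes of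
  the relation ``the interval between is separable'', where the hypothesis on separable \<open>H\<close> bounds
  the number of points in each interval. Second, on a countable set of points and a
  countable set of indices the intervals can be chosen disjoint for longer and longer finite sets
  of points as the index grows, and the uniform bound on the total variations bounds the sum.
  The two are glued along the countable components of a bipartite graph between indices and points.
\<close>

section \<open>Families tending to zero along an index set\<close>

lemma c0_familyI:
  assumes "\<And>\<epsilon>. \<epsilon> > 0 \<Longrightarrow> finite {i \<in> I. \<epsilon> \<le> \<bar>a i\<bar>}"
  shows "c0_family I a"
  using assms unfolding c0_family_def by blast

lemma c0_family_mono:
  assumes "c0_family I a" "J \<subseteq> I"
  shows "c0_family J a"
  unfolding c0_family_def
proof (intro allI impI)
  fix e :: real assume "e > 0"
  then have "finite {i \<in> I. e \<le> \<bar>a i\<bar>}" using assms(1) by (auto simp: c0_family_def)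
  then show "finite {i \<in> J. e \<le> \<bar>a i\<bar>}" by (rule rev_finite_subset) (use assms(2) in auto)
qed

lemma c0_family_Un:
  assumes "c0_family I a" "c0_family J a"
  shows "c0_family (I \<union> J) a"
  unfolding c0_family_def
proof (intro allI impI)
  fix e :: real assume "e > 0"
  then have "finite ({i \<in> I. e \<le> \<bar>a i\<bar>} \<union> {i \<in> J. e \<le> \<bar>a i\<bar>})"
    using assms by (auto simp: c0_family_def)
  then show "finite {i \<in> I \<union> J. e \<le> \<bar>a i\<bar>}" by (rule rev_finite_subset) auto
qed

lemma c0_family_cong:
  assumes "\<And>i. i \<in> I \<Longrightarrow> a i = b i"
  shows "c0_family I a \<longleftrightarrow> c0_family I b"
proof -
  have "{i \<in> I. e \<le> \<bar>a i\<bar>} = {i \<in> I. e \<le> \<bar>b i\<bar>}" for e using assms by auto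
  then show ?thesis by (simp add: c0_family_def)
qed

lemma c0_family_zero: "c0_family I (\<lambda>_. 0)"
  by (auto simp: c0_family_def not_le)

lemma c0_family_countable_support:
  assumes "c0_family I a"
  shows "countable {i \<in> I. a i \<noteq> 0}"
proof -
  have "{i \<in> I. a i \<noteq> 0} \<subseteq> (\<Union>n. {i \<in> I. inverse (real (Suc n)) \<le> \<bar>a i\<bar>})"
  proof
    fix i assume i: "i \<in> {i \<in> I. a i \<noteq> 0}"
    then have "0 < \<bar>a i\<bar>" by simp
    from reals_Archimedean[OF this] obtain n where "inverse (real (Suc n)) < \<bar>a i\<bar>" ..
    with i show "i \<in> (\<Union>n. {i \<in> I. inverse (real (Suc n)) \<le> \<bar>a i\<bar>})" by (auto intro: less_imp_le)
  qed
  moreover have "finite {i \<in> I. inverse (real (Suc n)) \<le> \<bar>a i\<bar>}" for n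
    using assms inverse_Suc[of n] unfolding c0_family_def by blast
  then have "countable (\<Union>n. {i \<in> I. inverse (real (Suc n)) \<le> \<bar>a i\<bar>})"
    by (intro countable_UN countableI_type countable_finite)
  ultimately show ?thesis by (rule countable_subset)
qed

section \<open>Uniform boundedness and disjoint sets of positive measure\<close>

lemma abs_le_all_imp_zero:
  fixes x :: real
  assumes "\<And>d. d > 0 \<Longrightarrow> \<bar>x\<bar> \<le> c * d" "c \<ge> 0"
  shows "x = 0"
proof (rule ccontr)
  assume "x \<noteq> 0"
  then have *: "\<bar>x\<bar> > 0" by simp
  \<comment> \<open>This \<open>d\<close> makes the bound at most half of
    \<open>\<bar>x\<bar>\<close>; the summand \<open>1\<close> keeps the denominator positive when
    \<open>c = 0\<close>.\<close>
  have "\<bar>x\<bar> \<le> c * (\<bar>x\<bar> / (2 * (c + 1)))" using * assms(2) by (intro assms(1)) auto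
  also have "\<dots> = \<bar>x\<bar> * (c / (2 * (c + 1)))" by simp
  also have "\<dots> \<le> \<bar>x\<bar> * (1/2)" using assms(2) by (intro mult_left_mono) (auto simp: field_simps)
  finally show False using * by simp
qed

text \<open>Baire category: the closed sets \<open>S n\<close> exhaust the space, so one of them
  contains a ball, and linearity carries the bound to the unit ball. Completeness is a hypothesis
  rather than a class constraint so as to cover bounded continuous functions on a merely topological
  domain.\<close>

lemma banach_steinhaus:
  fixes \<phi> :: "'i \<Rightarrow> 'b::real_normed_vector \<Rightarrow> real"
  assumes complete: "uniform_space_class.complete (UNIV :: 'b set)"
    and lin: "\<And>i. i \<in> I \<Longrightarrow> bounded_linear (\<phi> i)"
    and bd: "\<And>x. \<exists>c. \<forall>i\<in>I. \<bar>\<phi> i x\<bar> \<le> c"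
  shows "\<exists>C. \<forall>i\<in>I. \<forall>x. norm x \<le> 1 \<longrightarrow> \<bar>\<phi> i x\<bar> \<le> C"
proof -
  define S where "S n = {x. \<forall>i\<in>I. \<bar>\<phi> i x\<bar> \<le> real n}" for n :: nat
  have cl: "closed (S n)" for n
  proof -
    have "S n = (\<Inter>i\<in>I. {x. \<bar>\<phi> i x\<bar> \<le> real n})" by (auto simp: S_def)
    moreover have "closed {x. \<bar>\<phi> i x\<bar> \<le> real n}" if "i \<in> I" for i
      using linear_continuous_on[OF lin[OF that]]
      by (intro closed_Collect_le continuous_intros) auto
    ultimately show ?thesis by auto
  qed
  have un: "(\<Union>n. S n) = UNIV"
  proof -
    have "x \<in> (\<Union>n. S n)" for x
    proof -
      obtain c where c: "\<forall>i\<in>I. \<bar>\<phi> i x\<bar> \<le> c" using bd by blast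
      obtain n where "c \<le> real n" using real_arch_simple by blast
      with c show ?thesis by (auto simp: S_def intro: order_trans)
    qed
    then show ?thesis by auto
  qed
  have "\<exists>n. interior (S n) \<noteq> {}"
  proof (rule ccontr)
    assume "\<not> ?thesis"
    moreover have "Met_TC.mcomplete TYPE('b)"
      using complete by simp
    ultimately have "euclidean interior_of (\<Union>(range S)) = {}"
      using Met_TC.metric_Baire_category_alt[of "range S"] cl by auto
    with un show False by simp
  qed
  then obtain n x where "x \<in> interior (S n)" by auto
  then obtain e where e: "e > 0" "cball x e \<subseteq> S n" by (auto simp: mem_interior_cball)
  have "\<bar>\<phi> i y\<bar> \<le> 2 * real n / e" if i: "i \<in> I" and y: "norm y \<le> 1" for i y
  proof -
    interpret bounded_linear "\<phi> i" by (rule lin[OF i])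
    \<comment> \<open>The centre \<open>x\<close> need not be \<open>0\<close>, so
      \<open>e * \<phi> i y\<close> is a difference of two values bounded by \<open>n\<close>; hence
      the factor \<open>2\<close>.\<close>
    have "x + e *\<^sub>R y \<in> S n" "x \<in> S n" using e y by (auto simp: dist_norm)
    then have "\<bar>\<phi> i (x + e *\<^sub>R y)\<bar> \<le> n" "\<bar>\<phi> i x\<bar> \<le> n" using i by (auto simp: S_def)
    then have "\<bar>e * \<phi> i y\<bar> \<le> 2 * n" by (simp add: add scaleR)
    then show ?thesis using e(1) by (simp add: field_simps abs_mult)
  qed
  then show ?thesis by blast
qed

text \<open>The library's instance of \<^class>\<open>complete_space\<close> for bounded continuous functions
  asks for a metric domain.\<close>

lemma complete_bcontfun:
  "uniform_space_class.complete (UNIV :: ('a::topological_space \<Rightarrow>\<^sub>C 'b::complete_space) set)"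
proof (rule completeI)
  fix f :: "nat \<Rightarrow> 'a \<Rightarrow>\<^sub>C 'b"
  assume "Cauchy f"
  then have "\<exists>N. \<forall>m n x. N \<le> m \<and> N \<le> n \<longrightarrow> dist (f m x) (f n x) < e" if "e > 0" for e
    using metric_CauchyD[OF _ that] dist_fun_lt_imp_dist_val_lt by blast
  then obtain g where "uniform_limit UNIV f g sequentially"
    using uniformly_convergent_eq_cauchy[of "\<lambda>_. True" f]
    by (auto simp: uniform_limit_sequentially_iff)
  then show "\<exists>l\<in>UNIV. f \<longlonglongrightarrow> l"
    by (rule uniform_limit_bcontfunE[OF _ sequentially_bot]) auto
qed

text \<open>Finite total measure leaves room for only finitely many disjoint sets of measure above
  \<open>inverse (Suc n)\<close>, for each \<open>n\<close>.\<close>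

lemma countable_disjoint_positive_measure:
  assumes "finite_measure M" "disjoint_family_on U S" "\<And>x. x \<in> S \<Longrightarrow> U x \<in> sets M"
  shows "countable {x \<in> S. measure M (U x) \<noteq> 0}"
proof -
  interpret finite_measure M by fact
  have fin: "finite {x \<in> S. inverse (real (Suc n)) < measure M (U x)}" for n
  proof (rule finite_if_finite_subsets_card_bdd[of _ "nat \<lceil>measure M (space M) * Suc n\<rceil>", THEN conjunct1])
    fix G assume G: "G \<subseteq> {x \<in> S. inverse (real (Suc n)) < measure M (U x)}" "finite G"
    have "real (card G) * inverse (real (Suc n)) = (\<Sum>x\<in>G. inverse (real (Suc n)))" by simp
    also have "\<dots> \<le> (\<Sum>x\<in>G. measure M (U x))" using G(1) by (intro sum_mono) auto
    also have "\<dots> = measure M (\<Union>x\<in>G. U x)"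
      using G assms by (intro finite_measure_finite_Union[symmetric])
        (auto intro: disjoint_family_on_mono[OF _ assms(2)])
    also have "\<dots> \<le> measure M (space M)" by (rule bounded_measure)
    finally have "real (card G) \<le> measure M (space M) * Suc n" by (simp add: field_simps)
    then show "card G \<le> nat \<lceil>measure M (space M) * Suc n\<rceil>" by linarith
  qed
  have "{x \<in> S. measure M (U x) \<noteq> 0} \<subseteq> (\<Union>n. {x \<in> S. inverse (real (Suc n)) < measure M (U x)})"
  proof
    fix x assume x: "x \<in> {x \<in> S. measure M (U x) \<noteq> 0}"
    then have "0 < measure M (U x)" by (simp add: zero_less_measure_iff)
    from reals_Archimedean[OF this] x show "x \<in> (\<Union>n. {x \<in> S. inverse (real (Suc n)) < measure M (U x)})"
      by auto
  qed
  then show ?thesis by (rule countable_subset) (intro countable_UN countableI_type countable_finite fin)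
qed

section \<open>Continuous steps, infima and Radon measures on a compact line\<close>

lemma step_function:
  fixes s t :: "'a::linorder_topology"
  assumes "compact (UNIV :: 'a set)" "s < t"
  shows "\<exists>f::'a \<Rightarrow> real. continuous_on UNIV f \<and> (\<forall>z. 0 \<le> f z \<and> f z \<le> 1) \<and>
    (\<forall>z\<le>s. f z = 1) \<and> (\<forall>z\<ge>t. f z = 0)"
proof -
  have "compact_space (euclidean :: 'a topology)"
    using assms(1) by (simp add: compact_space_def compactin_euclidean_iff)
  then have "normal_space (euclidean :: 'a topology)"
    by (rule compact_Hausdorff_or_regular_imp_normal_space) (simp add: Hausdorff_space_def t2_space.hausdorff disjnt_def, metis hausdorff)
  moreover have "disjnt {t..} {..s}" using assms(2) by (auto simp: disjnt_def)
  ultimately obtain f where "continuous_map (euclidean :: 'a topology) (top_of_set {0..1::real}) f"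
    "f ` {t..} \<subseteq> {0}" "f ` {..s} \<subseteq> {1}"
    using Urysohn_lemma[of "euclidean :: 'a topology" "{t..}" "{..s}" 0 1] by auto
  then show ?thesis
    by (intro exI[of _ f]) (auto simp: continuous_map_in_subtopology image_subset_iff Pi_iff)
qed

text \<open>The infimum is the least element of the compact set \<open>closure X\<close>; passing to
  the closure adds no restriction on lower bounds, because \<open>{u..}\<close> is closed.\<close>

lemma compact_imp_glb:
  fixes X :: "'a::linorder_topology set"
  assumes "compact (UNIV :: 'a set)" "X \<noteq> {}"
  shows "\<exists>p. is_glb X p"
proof -
  have "compact (closure X)" using assms(1) closed_Int_compact[of "closure X" UNIV] by simp
  then obtain p where p: "p \<in> closure X" "\<forall>x\<in>closure X. p \<le> x"
    using compact_attains_inf[of "closure X"] assms(2) by auto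
  have "u \<le> p" if "\<forall>a\<in>X. u \<le> a" for u
  proof -
    have "closure X \<subseteq> {u..}" using that by (intro closure_minimal) auto
    then show ?thesis using p(1) by auto
  qed
  with p closure_subset[of X] show ?thesis unfolding is_glb_def by blast
qed

lemma radon_right_continuous:
  fixes t :: "'a::linorder_topology"
  assumes M: "finite_radon M" and d: "d > 0" and t: "\<not> is_max_pt t"
  shows "\<exists>c>t. measure M {t<..<c} \<le> d"
proof (cases "right_isolated t")
  case True
  with t obtain s where "t < s" "{t<..<s} = {}" by (auto simp: right_isolated_def)
  then show ?thesis using d by (intro exI[of _ s]) simp
next
  case False
  interpret finite_measure M using M by (simp add: finite_radon_def)
  have s[simp]: "sets M = sets borel" using M by (simp add: finite_radon_def)
  have "emeasure M {t<..} = (SUP C\<in>{C. compact C \<and> C \<subseteq> {t<..}}. emeasure M C)"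
    using M by (auto simp: finite_radon_def)
  moreover have "emeasure M {t<..} \<noteq> \<infinity>" by (simp add: emeasure_eq_measure)
  moreover have "{C. compact C \<and> C \<subseteq> {t<..}} \<noteq> {}" by (auto intro: exI[of _ "{}"])
  ultimately have "\<exists>C\<in>{C. compact C \<and> C \<subseteq> {t<..}}. emeasure M {t<..} < emeasure M C + ennreal d"
    by (intro SUP_approx_ennreal[OF d])
  then obtain C where C: "compact C" "C \<subseteq> {t<..}" "emeasure M {t<..} < emeasure M C + ennreal d"
    by blast
  have lt: "measure M {t<..} < measure M C + d"
    using C(3) d by (simp add: emeasure_eq_measure ennreal_less_iff flip: ennreal_plus)
  obtain c where c: "t < c" "\<forall>x\<in>C. c \<le> x"
  proof (cases "C = {}")
    case True
    then show ?thesis using that t by (auto simp: is_max_pt_def not_le)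
  next
    case False
    then show ?thesis using compact_attains_inf[OF C(1)] C(2) that by (meson greaterThan_iff subsetD)
  qed
  have Cs: "C \<in> sets borel" using C(1) by (simp add: compact_imp_closed)
  have "measure M {t<..<c} + measure M C = measure M ({t<..<c} \<union> C)"
    using c Cs by (intro finite_measure_Union[symmetric]) force+
  also have "\<dots> \<le> measure M {t<..}" using C(2) by (intro finite_measure_mono) auto
  finally show ?thesis using lt c(1) by (intro exI[of _ c]) auto
qed

text \<open>Off \<open>U\<close> the function equals the indicator of \<open>{..t}\<close>, and on
  \<open>U\<close> the two differ by at most \<open>1\<close>.\<close>

lemma integral_near_initial_segment:
  fixes f :: "'a::linorder_topology \<Rightarrow> real"
  assumes M: "finite_measure M" "sets M = sets borel"
    and f: "continuous_on UNIV f" "\<And>z. 0 \<le> f z" "\<And>z. f z \<le> 1"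
    and U: "U \<in> sets borel"
    and out: "\<And>z. z \<notin> U \<Longrightarrow> f z = (if z \<le> t then 1 else 0)"
  shows "\<bar>measure M {..t} - integral\<^sup>L M f\<bar> \<le> measure M U"
proof -
  interpret finite_measure M by fact
  have [simp]: "sets M = sets borel" by fact
  have sp: "space M = UNIV" using sets_eq_imp_space_eq[OF M(2)] by simp
  have fm: "f \<in> borel_measurable M"
    using borel_measurable_continuous_onI[OF f(1)] measurable_cong_sets[OF M(2) refl] by blast
  have int: "integrable M f" using f fm by (intro integrable_const_bound[of _ 1]) auto
  have "measure M {..t} - integral\<^sup>L M f = (\<integral>z. indicator {..t} z - f z \<partial>M)"
    using int by (subst Bochner_Integration.integral_diff) (auto simp: sp emeasure_eq_measure)
  also have "\<bar>\<dots>\<bar> \<le> (\<integral>z. \<bar>indicator {..t} z - f z\<bar> \<partial>M)" by (rule integral_abs_bound)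
  also have "\<dots> \<le> (\<integral>z. indicator U z \<partial>M)"
  proof (intro integral_mono)
    fix z show "\<bar>indicator {..t} z - f z\<bar> \<le> (indicator U z :: real)"
      using f(2,3)[of z] out[of z] by (cases "z \<in> U") (auto simp: indicator_def)
  next
    show "integrable M (indicator U :: 'a \<Rightarrow> real)" using U by (simp add: emeasure_eq_measure)
  next
    show "integrable M (\<lambda>z. \<bar>indicator {..t} z - f z\<bar>)"
      using int by (intro integrable_abs Bochner_Integration.integrable_diff) (auto simp: emeasure_eq_measure)
  qed
  also have "\<dots> = measure M U" using U by (simp add: sp)
  finally show ?thesis .
qed

definition step :: "'a::linorder_topology \<Rightarrow> 'a \<Rightarrow> 'a \<Rightarrow> real" where
  "step s t = (SOME f. continuous_on UNIV f \<and> (\<forall>z. 0 \<le> f z \<and> f z \<le> 1) \<and>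
    (\<forall>z\<le>s. f z = 1) \<and> (\<forall>z\<ge>t. f z = 0))"

lemma greaterThanAtMost_borel [measurable]: "{s<..t::'a::linorder_topology} \<in> sets borel"
proof -
  have "{s<..t} = {s<..} \<inter> {..t}" by auto
  then show ?thesis by simp
qed

section \<open>The functionals and measures behind a weak*-null family\<close>

locale weak_star_null_family =
  fixes I :: "'i set" and M1 M2 :: "'i \<Rightarrow> 'a::linorder_topology measure" and F :: "'i \<Rightarrow> 'a \<Rightarrow> real"
  assumes compact_UNIV: "compact (UNIV :: 'a set)"
    and radon1: "i \<in> I \<Longrightarrow> finite_radon (M1 i)"
    and radon2: "i \<in> I \<Longrightarrow> finite_radon (M2 i)"
    and F_eq: "i \<in> I \<Longrightarrow> F i t = measure (M1 i) {..t} - measure (M2 i) {..t}"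
    and null: "continuous_on UNIV f \<Longrightarrow> c0_family I (\<lambda>i. integral\<^sup>L (M1 i) f - integral\<^sup>L (M2 i) f)"
begin

text \<open>The value at \<open>f\<close> of the functional on \<open>C(K)\<close> that
  \<open>F i\<close> represents.\<close>

definition pair :: "'i \<Rightarrow> ('a \<Rightarrow> real) \<Rightarrow> real" where
  "pair i f = integral\<^sup>L (M1 i) f - integral\<^sup>L (M2 i) f"

text \<open>Since \<open>M1 i\<close> and \<open>M2 i\<close> need not be mutually singular, \<open>var i\<close> only dominates the
  variation of \<open>M1 i - M2 i\<close>, and it need not be bounded in \<open>i\<close>.\<close>

definition var :: "'i \<Rightarrow> 'a set \<Rightarrow> real" where
  "var i U = measure (M1 i) U + measure (M2 i) U"

lemma pair_c0: "continuous_on UNIV f \<Longrightarrow> c0_family I (\<lambda>i. pair i f)"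
  using null unfolding pair_def .

lemma step:
  fixes s t :: 'a
  assumes "s < t"
  shows step_continuous: "continuous_on UNIV (step s t)"
    and step_nonneg: "\<And>z. 0 \<le> step s t z" and step_le_1: "\<And>z. step s t z \<le> 1"
    and step_left: "\<And>z. z \<le> s \<Longrightarrow> step s t z = 1"
    and step_right: "\<And>z. t \<le> z \<Longrightarrow> step s t z = 0"
  using someI_ex[OF step_function[OF compact_UNIV assms]] unfolding step_def by blast+

lemma finite_measure1: "i \<in> I \<Longrightarrow> finite_measure (M1 i)"
  and finite_measure2: "i \<in> I \<Longrightarrow> finite_measure (M2 i)"
  and sets1: "i \<in> I \<Longrightarrow> sets (M1 i) = sets borel"
  and sets2: "i \<in> I \<Longrightarrow> sets (M2 i) = sets borel"
  using radon1 radon2 by (auto simp: finite_radon_def)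

lemma space1: "i \<in> I \<Longrightarrow> space (M1 i) = UNIV"
  and space2: "i \<in> I \<Longrightarrow> space (M2 i) = UNIV"
  using sets_eq_imp_space_eq[OF sets1] sets_eq_imp_space_eq[OF sets2] by simp_all

lemma continuous_bounded:
  fixes f :: "'a \<Rightarrow> real"
  assumes "continuous_on UNIV f"
  shows "\<exists>B. \<forall>z. \<bar>f z\<bar> \<le> B"
  using compact_imp_bounded[OF compact_continuous_image[OF assms compact_UNIV]]
  by (auto simp: bounded_iff)

lemma integrable_continuous:
  assumes "i \<in> I" "continuous_on UNIV f"
  shows "integrable (M1 i) (f :: 'a \<Rightarrow> real)" "integrable (M2 i) f"
proof -
  obtain B where "\<forall>z. \<bar>f z\<bar> \<le> B" using continuous_bounded[OF assms(2)] by blast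
  moreover have "f \<in> borel_measurable borel" using assms(2) by (rule borel_measurable_continuous_onI)
  then have "f \<in> borel_measurable (M1 i)" "f \<in> borel_measurable (M2 i)"
    using measurable_cong_sets[OF sets1[OF assms(1)] refl] measurable_cong_sets[OF sets2[OF assms(1)] refl]
    by blast+
  ultimately show "integrable (M1 i) f" "integrable (M2 i) f"
    by (auto intro!: finite_measure.integrable_const_bound[OF finite_measure1[OF assms(1)], of _ B]
      finite_measure.integrable_const_bound[OF finite_measure2[OF assms(1)], of _ B])
qed

lemma pair_simps:
  assumes "i \<in> I" "continuous_on UNIV f" "continuous_on UNIV g"
  shows pair_add: "pair i (\<lambda>z. f z + g z) = pair i f + pair i g"
    and pair_diff: "pair i (\<lambda>z. f z - g z) = pair i f - pair i g"
    and pair_mult: "pair i (\<lambda>z. c * f z) = c * pair i f"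
  using integrable_continuous[OF assms(1,2)] integrable_continuous[OF assms(1,3)]
  by (simp_all add: pair_def algebra_simps)

lemma pair_sum:
  assumes "i \<in> I" "\<And>t. t \<in> Y \<Longrightarrow> continuous_on UNIV (f t)"
  shows "pair i (\<lambda>z. \<Sum>t\<in>Y. f t z) = (\<Sum>t\<in>Y. pair i (f t))"
  using integrable_continuous[OF assms(1,2)]
  by (simp add: pair_def Bochner_Integration.integral_sum sum_subtractf)

lemma var_nonneg: "0 \<le> var i U"
  by (simp add: var_def)

lemma var_mono:
  assumes "i \<in> I" "U \<subseteq> V" "V \<in> sets borel"
  shows "var i U \<le> var i V"
  unfolding var_def using assms sets1 sets2
  by (intro add_mono finite_measure.finite_measure_mono finite_measure1 finite_measure2) auto

lemma var_Un:
  assumes "i \<in> I" "U \<inter> V = {}" "U \<in> sets borel" "V \<in> sets borel"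
  shows "var i (U \<union> V) = var i U + var i V"
  unfolding var_def
  using finite_measure.finite_measure_Union[OF finite_measure1[OF assms(1)], of U V]
    finite_measure.finite_measure_Union[OF finite_measure2[OF assms(1)], of U V] assms sets1 sets2
  by simp

lemma F_diff_le_var:
  assumes "i \<in> I" "s \<le> t"
  shows "\<bar>F i t - F i s\<bar> \<le> var i {s<..t}"
proof -
  have *: "measure M {..t} = measure M {..s} + measure M {s<..t}"
    if "finite_measure M" "sets M = sets borel" for M :: "'a measure"
  proof -
    have "{..t} = {..s} \<union> {s<..t}" using assms(2) by auto
    moreover have "{..s} \<inter> {s<..t} = {}" by auto
    ultimately show ?thesis using finite_measure.finite_measure_Union[OF that(1), of "{..s}" "{s<..t}"]
      by (simp add: that(2) greaterThanAtMost_borel)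
  qed
  show ?thesis
    using *[OF finite_measure1 sets1] *[OF finite_measure2 sets2] assms(1)
    by (simp add: F_eq var_def abs_diff_le_iff measure_nonneg abs_le_iff)
qed

lemma pair_near:
  assumes "i \<in> I" "continuous_on UNIV f" "\<And>z. 0 \<le> f z" "\<And>z. f z \<le> 1" "U \<in> sets borel"
    and "\<And>z. z \<notin> U \<Longrightarrow> f z = (if z \<le> t then 1 else 0)"
  shows "\<bar>F i t - pair i f\<bar> \<le> var i U"
  using integral_near_initial_segment[OF finite_measure1 sets1, of i f U t]
    integral_near_initial_segment[OF finite_measure2 sets2, of i f U t] assms
  by (simp add: F_eq var_def pair_def)

lemma near_right:
  assumes "i \<in> I" "t < s"
  shows "\<bar>F i t - pair i (step t s)\<bar> \<le> var i {t<..<s}"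
  using step[OF assms(2)] by (intro pair_near assms(1)) auto

text \<open>At \<open>t\<close> itself the step is already \<open>0\<close> while the indicator of
  \<open>{..t}\<close> is \<open>1\<close>, so the interval must be closed at \<open>t\<close>,
  unlike in \<open>near_right\<close>.\<close>

lemma near_left:
  assumes "i \<in> I" "s < t"
  shows "\<bar>F i t - pair i (step s t)\<bar> \<le> var i {s<..t}"
  using step[OF assms(2)] by (intro pair_near assms(1)) auto

lemma var_right_continuous:
  assumes "i \<in> I" "\<not> is_max_pt t" "d > 0"
  shows "\<exists>c>t. var i {t<..<c} \<le> d"
proof -
  obtain c1 where c1: "t < c1" "measure (M1 i) {t<..<c1} \<le> d / 2"
    using radon_right_continuous[OF radon1[OF assms(1)], of "d / 2" t] assms by auto
  obtain c2 where c2: "t < c2" "measure (M2 i) {t<..<c2} \<le> d / 2"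
    using radon_right_continuous[OF radon2[OF assms(1)], of "d / 2" t] assms by auto
  have "measure (M1 i) {t<..<min c1 c2} \<le> measure (M1 i) {t<..<c1}"
    by (intro finite_measure.finite_measure_mono finite_measure1 assms) (auto simp: sets1 assms)
  moreover have "measure (M2 i) {t<..<min c1 c2} \<le> measure (M2 i) {t<..<c2}"
    by (intro finite_measure.finite_measure_mono finite_measure2 assms) (auto simp: sets2 assms)
  ultimately show ?thesis using c1 c2 by (intro exI[of _ "min c1 c2"]) (auto simp: var_def)
qed

text \<open>Banach-Steinhaus on the bounded continuous functions. Each functional is bounded by
  \<open>var i UNIV\<close>, which may vary with \<open>i\<close>; pointwise boundedness comes from
  nullity, as only finitely many values reach \<open>1\<close>.\<close>

lemma uniform_bound:
  "\<exists>C\<ge>0. \<forall>i\<in>I. \<forall>f. continuous_on UNIV f \<and> (\<forall>z. \<bar>f z\<bar> \<le> 1) \<longrightarrow> \<bar>pair i f\<bar> \<le> C"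
proof -
  define \<phi> where "\<phi> i x = pair i (apply_bcontfun x)" for i and x :: "'a \<Rightarrow>\<^sub>C real"
  have lin: "bounded_linear (\<phi> i)" if i: "i \<in> I" for i
  proof (rule bounded_linear_intro[where K="var i UNIV"])
    fix x y :: "'a \<Rightarrow>\<^sub>C real" and r
    show "\<phi> i (x + y) = \<phi> i x + \<phi> i y" unfolding \<phi>_def
      using pair_add[OF i, of "apply_bcontfun x" "apply_bcontfun y"] by (simp add: plus_bcontfun.rep_eq)
    show "\<phi> i (r *\<^sub>R x) = r *\<^sub>R \<phi> i x" unfolding \<phi>_def
      using pair_mult[OF i, of "apply_bcontfun x" "apply_bcontfun x" r]
      by (simp add: scaleR_bcontfun.rep_eq)
    have "\<bar>integral\<^sup>L M (apply_bcontfun x)\<bar> \<le> norm x * measure M UNIV"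
      if M: "finite_measure M" "sets M = sets borel" "integrable M (apply_bcontfun x)" for M
    proof -
      have "\<bar>integral\<^sup>L M (apply_bcontfun x)\<bar> \<le> (\<integral>z. \<bar>apply_bcontfun x z\<bar> \<partial>M)"
        by (rule integral_abs_bound)
      also have "\<dots> \<le> (\<integral>z. norm x \<partial>M)"
        using M norm_bounded[of x] by (intro integral_mono finite_measure.integrable_const) auto
      also have "\<dots> = norm x * measure M UNIV"
        using sets_eq_imp_space_eq[OF M(2)] by simp
      finally show ?thesis .
    qed
    from this[OF finite_measure1[OF i] sets1[OF i]] this[OF finite_measure2[OF i] sets2[OF i]]
    show "norm (\<phi> i x) \<le> norm x * var i UNIV"
      using integrable_continuous[OF i, of "apply_bcontfun x"]
      by (simp add: \<phi>_def pair_def var_def distrib_left)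
  qed
  have bd: "\<exists>c. \<forall>i\<in>I. \<bar>\<phi> i x\<bar> \<le> c" for x
  proof -
    have "finite {i \<in> I. 1 \<le> \<bar>\<phi> i x\<bar>}"
      using pair_c0[of "apply_bcontfun x"] by (auto simp: c0_family_def \<phi>_def)
    then obtain c where c: "\<forall>i\<in>{i \<in> I. 1 \<le> \<bar>\<phi> i x\<bar>}. \<bar>\<phi> i x\<bar> \<le> c"
      using bdd_above_finite[of "(\<lambda>i. \<bar>\<phi> i x\<bar>) ` {i \<in> I. 1 \<le> \<bar>\<phi> i x\<bar>}"] by (auto simp: bdd_above_def)
    have "\<bar>\<phi> i x\<bar> \<le> max 1 c" if "i \<in> I" for i
      using c that by (cases "1 \<le> \<bar>\<phi> i x\<bar>") (auto simp: le_max_iff_disj)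
    then show ?thesis by blast
  qed
  have "\<exists>C. \<forall>i\<in>I. \<forall>x. norm x \<le> 1 \<longrightarrow> \<bar>\<phi> i x\<bar> \<le> C"
  proof (rule banach_steinhaus)
    show "uniform_space_class.complete (UNIV :: ('a \<Rightarrow>\<^sub>C real) set)" by (rule complete_bcontfun)
    show "bounded_linear (\<phi> i)" if "i \<in> I" for i using lin that .
    show "\<exists>c. \<forall>i\<in>I. \<bar>\<phi> i x\<bar> \<le> c" for x by (rule bd)
  qed
  then obtain C where C: "\<forall>i\<in>I. \<forall>x. norm x \<le> 1 \<longrightarrow> \<bar>\<phi> i x\<bar> \<le> C" by blast
  have "\<bar>pair i f\<bar> \<le> max 0 C" if "i \<in> I" "continuous_on UNIV f" "\<forall>z. \<bar>f z\<bar> \<le> 1" for i f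
  proof -
    have "f \<in> bcontfun" using that by (auto simp: bcontfun_def bounded_iff)
    then have f: "apply_bcontfun (Bcontfun f) = f" by (rule Bcontfun_inverse)
    have "norm (Bcontfun f) \<le> 1" using that(3) by (intro norm_bound) (simp add: f)
    then have "\<bar>\<phi> i (Bcontfun f)\<bar> \<le> C" using C that(1) by blast
    then show ?thesis by (simp add: \<phi>_def f)
  qed
  then show ?thesis by (intro exI[of _ "max 0 C"]) auto
qed

text \<open>Up to a small error each summand is the pairing with a bump \<open>g t\<close> living on
  \<open>{t<..<s t}\<close>. These intervals are disjoint, so the bumps with suitable signs add up
  to one test function bounded by \<open>1\<close>.\<close>

lemma sum_step_bound:
  assumes C: "\<forall>f. continuous_on UNIV f \<and> (\<forall>z. \<bar>f z\<bar> \<le> 1) \<longrightarrow> \<bar>pair i f\<bar> \<le> C"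
    and i: "i \<in> I" and Y: "finite Y"
    and s: "\<And>t. t \<in> Y \<Longrightarrow> t < s t" "\<And>t t'. t \<in> Y \<Longrightarrow> t' \<in> Y \<Longrightarrow> t < t' \<Longrightarrow> s t \<le> t'"
  shows "(\<Sum>t\<in>Y. \<bar>F i t - pair i (step t (s t))\<bar>) \<le> C"
proof (rule field_le_epsilon)
  fix e :: real assume "e > 0"
  \<comment> \<open>One error \<open>d\<close> per point of \<open>Y\<close> costs at most
    \<open>e\<close> in total; the \<open>+ 1\<close> covers empty \<open>Y\<close>.\<close>
  define d where "d = e / (card Y + 1)"
  have d: "d > 0" "card Y * d \<le> e" using \<open>e > 0\<close> by (auto simp: d_def field_simps)
  have "\<exists>c. t < c \<and> c \<le> s t \<and> var i {t<..<c} \<le> d" if t: "t \<in> Y" for t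
  proof -
    have "\<not> is_max_pt t" using s(1)[OF t] by (auto simp: is_max_pt_def not_le)
    from var_right_continuous[OF i this d(1)] obtain c where c: "t < c" "var i {t<..<c} \<le> d" by blast
    have "var i {t<..<min c (s t)} \<le> var i {t<..<c}" by (intro var_mono i) auto
    then show ?thesis using c s(1)[OF t] by (intro exI[of _ "min c (s t)"]) auto
  qed
  then obtain c where c: "\<And>t. t \<in> Y \<Longrightarrow> t < c t" "\<And>t. t \<in> Y \<Longrightarrow> c t \<le> s t"
    "\<And>t. t \<in> Y \<Longrightarrow> var i {t<..<c t} \<le> d" by metis
  define g where "g t z = step t (c t) z - step t (s t) z" for t z
  \<comment> \<open>The signs turn the sum of absolute values into a single pairing.\<close>
  define \<sigma> where "\<sigma> t = sgn (pair i (g t))" for t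
  have g_cont: "continuous_on UNIV (g t)" if "t \<in> Y" for t
    unfolding g_def using c s that by (intro continuous_on_diff step_continuous) auto
  have g0: "g t z = 0" if "t \<in> Y" "z \<notin> {t<..<s t}" for t z
    using that c(1,2)[OF that(1)] s(1)[OF that(1)]
    by (cases "z \<le> t") (auto simp: g_def step_left step_right)
  have g1: "\<bar>g t z\<bar> \<le> 1" if "t \<in> Y" for t z
    using step(2,3)[OF c(1)[OF that], of z] step(2,3)[OF s(1)[OF that], of z] by (auto simp: g_def)
  have pg: "pair i (g t) = pair i (step t (c t)) - pair i (step t (s t))" if "t \<in> Y" for t
    unfolding g_def using c(1) s(1) that by (intro pair_diff i step_continuous) auto
  have bound: "\<bar>\<Sum>t\<in>Y. \<sigma> t * g t z\<bar> \<le> 1" for z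
  proof (cases "\<exists>t\<in>Y. z \<in> {t<..<s t}")
    case True
    then obtain t where t: "t \<in> Y" "z \<in> {t<..<s t}" by blast
    have "g t' z = 0" if "t' \<in> Y" "t' \<noteq> t" for t'
    proof (rule g0[OF that(1)])
      show "z \<notin> {t'<..<s t'}"
        using that t s(2)[of t t'] s(2)[of t' t] by (cases "t < t'") force+
    qed
    then have "(\<Sum>t'\<in>Y. \<sigma> t' * g t' z) = \<sigma> t * g t z"
      using t Y by (subst sum.remove[of _ t]) auto
    also have "\<bar>\<dots>\<bar> \<le> 1 * 1"
      unfolding abs_mult using g1[OF t(1)] by (intro mult_mono) (auto simp: \<sigma>_def sgn_if)
    finally show ?thesis by simp
  next
    case False
    then have "\<And>t. t \<in> Y \<Longrightarrow> g t z = 0" using g0 by blast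
    then show ?thesis by simp
  qed
  have "(\<Sum>t\<in>Y. \<bar>pair i (g t)\<bar>) = (\<Sum>t\<in>Y. pair i (\<lambda>z. \<sigma> t * g t z))"
    using pair_mult[OF i g_cont g_cont] by (intro sum.cong) (auto simp: \<sigma>_def abs_sgn mult.commute[of "pair i _"])
  also have "\<dots> = pair i (\<lambda>z. \<Sum>t\<in>Y. \<sigma> t * g t z)"
    using g_cont by (intro pair_sum[symmetric] i continuous_intros) auto
  also have "\<dots> \<le> C"
  proof -
    have "continuous_on UNIV (\<lambda>z. \<Sum>t\<in>Y. \<sigma> t * g t z)" using g_cont by (intro continuous_intros) auto
    then have "\<bar>pair i (\<lambda>z. \<Sum>t\<in>Y. \<sigma> t * g t z)\<bar> \<le> C" using C bound by blast
    then show ?thesis by (rule abs_le_D1)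
  qed
  finally have 1: "(\<Sum>t\<in>Y. \<bar>pair i (g t)\<bar>) \<le> C" .
  have "(\<Sum>t\<in>Y. \<bar>F i t - pair i (step t (s t))\<bar>) \<le> (\<Sum>t\<in>Y. d + \<bar>pair i (g t)\<bar>)"
  proof (rule sum_mono)
    fix t assume t: "t \<in> Y"
    show "\<bar>F i t - pair i (step t (s t))\<bar> \<le> d + \<bar>pair i (g t)\<bar>"
      using near_right[OF i c(1)[OF t]] c(3)[OF t] pg[OF t] by linarith
  qed
  also have "\<dots> = card Y * d + (\<Sum>t\<in>Y. \<bar>pair i (g t)\<bar>)" by (simp add: sum.distrib)
  finally show "(\<Sum>t\<in>Y. \<bar>F i t - pair i (step t (s t))\<bar>) \<le> C + e" using 1 d(2) by linarith
qed

section \<open>Influence of the right character of a point\<close>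

text \<open>As \<open>a\<close> descends to \<open>t\<close> along \<open>A\<close>,
  \<open>pair i (step t a)\<close> tends to \<open>F i t\<close>. So an index with
  \<open>F i t \<noteq> 0\<close> lies in the support of one of countably many null
  families.\<close>

lemma countable_support:
  assumes "countable_right_char t" "\<not> right_isolated t"
  shows "countable {i \<in> I. F i t \<noteq> 0}"
proof -
  obtain A where A: "countable A" "A \<subseteq> {t<..}" "is_glb A t"
    using assms by (auto simp: countable_right_char_def)
  have "{i \<in> I. F i t \<noteq> 0} \<subseteq> (\<Union>a\<in>A. {i \<in> I. pair i (step t a) \<noteq> 0})"
  proof (rule ccontr)
    assume "\<not> ?thesis"
    then obtain i where i: "i \<in> I" "F i t \<noteq> 0" "\<And>a. a \<in> A \<Longrightarrow> pair i (step t a) = 0" by blast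
    have "\<bar>F i t\<bar> \<le> 1 * d" if d: "d > 0" for d
    proof -
      have "\<not> is_max_pt t" using assms(2) by (auto simp: right_isolated_def)
      from var_right_continuous[OF i(1) this d] obtain c where c: "t < c" "var i {t<..<c} \<le> d" by blast
      then obtain a where a: "a \<in> A" "a < c" using A(3) unfolding is_glb_def by (meson not_le)
      have "var i {t<..<a} \<le> var i {t<..<c}" using a by (intro var_mono i) auto
      then show ?thesis using near_right[OF i(1), of t a] i(3)[OF a(1)] A(2) a c by auto
    qed
    from abs_le_all_imp_zero[OF this] i(2) show False by auto
  qed
  moreover have "countable (\<Union>a\<in>A. {i \<in> I. pair i (step t a) \<noteq> 0})"
    using A by (intro countable_UN c0_family_countable_support pair_c0 step_continuous) auto
  ultimately show ?thesis by (rule countable_subset)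
qed

text \<open>For such \<open>t\<close> the indicator of \<open>{..t}\<close> is itself continuous: it
  is constant, or a step across an empty interval.\<close>

lemma right_isolated_c0:
  assumes "right_isolated t"
  shows "c0_family I (\<lambda>i. F i t)"
proof (cases "is_max_pt t")
  case True
  have "F i t = pair i (\<lambda>_. 1)" if "i \<in> I" for i
  proof -
    have "{..t} = UNIV" using True by (auto simp: is_max_pt_def)
    then show ?thesis using that by (simp add: F_eq pair_def space1 space2)
  qed
  with pair_c0[of "\<lambda>_. 1"] show ?thesis using c0_family_cong[of I "\<lambda>i. F i t"] by fastforce
next
  case False
  then obtain s where s: "t < s" "{t<..<s} = {}" using assms by (auto simp: right_isolated_def)
  have "F i t = pair i (step t s)" if "i \<in> I" for i
    using near_right[OF that s(1)] s(2) by (simp add: var_def)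
  with pair_c0[OF step_continuous[OF s(1)]] show ?thesis
    using c0_family_cong[of I "\<lambda>i. F i t"] by fastforce
qed

text \<open>Countably many indices require only countably many points \<open>c i n\<close>, which
  cannot have infimum \<open>t\<close>. Some \<open>u > t\<close> lies below them all, so on
  \<open>{t<..<u}\<close> every \<open>var i\<close> with \<open>i \<in> J\<close> vanishes and
  \<open>F i t\<close> equals a single null family along \<open>J\<close>.\<close>

lemma uncountable_right_char_c0:
  assumes "\<not> countable_right_char t"
  shows "c0_family I (\<lambda>i. F i t)"
proof (rule c0_familyI, rule ccontr)
  fix e :: real assume "e > 0" and inf: "infinite {i \<in> I. e \<le> \<bar>F i t\<bar>}"
  obtain J where J: "J \<subseteq> {i \<in> I. e \<le> \<bar>F i t\<bar>}" "countable J" "infinite J"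
    using infinite_countable_subset'[OF inf] by blast
  have nmax: "\<not> is_max_pt t" using assms by (auto simp: countable_right_char_def right_isolated_def)
  have "\<exists>c>t. var i {t<..<c} \<le> inverse (Suc n)" if "i \<in> J" for i n
    using J(1) that nmax by (intro var_right_continuous) auto
  then obtain c where c: "\<And>i n. i \<in> J \<Longrightarrow> t < c i n" 
    "\<And>i n. i \<in> J \<Longrightarrow> var i {t<..<c i n} \<le> inverse (Suc n)" by metis
  let ?A = "\<Union>i\<in>J. range (c i)"
  have "countable ?A" using J by auto
  moreover have "?A \<subseteq> {t<..}" using c(1) by auto
  ultimately have "\<not> is_glb ?A t" using assms unfolding countable_right_char_def by blast
  then obtain u where u: "t < u" "\<forall>a\<in>?A. u \<le> a"
    using c(1) by (auto simp: is_glb_def not_le less_imp_le)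
  have "F i t = pair i (step t u)" if i: "i \<in> J" for i
  proof -
    have iI: "i \<in> I" using J i by auto
    have "var i {t<..<u} \<le> inverse (Suc n)" for n
    proof -
      have "u \<le> c i n" using u(2) i by auto
      then have "{t<..<u} \<subseteq> {t<..<c i n}" by auto
      then have "var i {t<..<u} \<le> var i {t<..<c i n}" by (intro var_mono iI) auto
      with c(2)[OF i, of n] show ?thesis by simp
    qed
    then have "var i {t<..<u} \<le> 0"
      using reals_Archimedean[of "var i {t<..<u}"] by (meson not_le)
    with near_right[OF iI u(1)] show ?thesis by simp
  qed
  then have "J \<subseteq> {i \<in> I. e \<le> \<bar>pair i (step t u)\<bar>}" using J(1) by auto
  moreover have "finite {i \<in> I. e \<le> \<bar>pair i (step t u)\<bar>}"
    using pair_c0[OF step_continuous[OF u(1)]] \<open>e > 0\<close> by (auto simp: c0_family_def)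
  ultimately show False using J(3) by (meson finite_subset)
qed

end

section \<open>Separable intervals and the equivalence relation they define\<close>

text \<open>Separability is not hereditary in general, but \<open>D\<close> is dense in the open
  interval, and the two end points are added to it.\<close>

lemma separable_interval:
  fixes C :: "'a::linorder_topology set"
  assumes "separable_set C" "{c..d} \<subseteq> C"
  shows "separable_set {c..d}"
proof (cases "c \<le> d")
  case True
  obtain D where D: "D \<subseteq> C" "countable D" "C \<subseteq> closure D"
    using assms(1) by (auto simp: separable_set_def)
  have "z \<in> closure (D \<inter> {c..d} \<union> {c, d})" if z: "z \<in> {c..d}" for z
  proof (cases "z = c \<or> z = d")
    case True
    then show ?thesis using closure_subset[of "D \<inter> {c..d} \<union> {c, d}"] by auto
  next
    case False
    then have "z \<in> {c<..<d} \<inter> closure D" using z assms(2) D(3) by auto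
    then have "z \<in> closure ({c<..<d} \<inter> D)"
      using open_Int_closure_subset[of "{c<..<d}" D] by auto
    then show ?thesis by (rule rev_subsetD) (intro closure_mono, auto)
  qed
  then show ?thesis using True D(2) unfolding separable_set_def
    by (intro exI[of _ "D \<inter> {c..d} \<union> {c, d}"]) auto
next
  case False
  then show ?thesis by (auto simp: separable_set_def)
qed

lemma separable_set_Un:
  assumes "separable_set A" "separable_set B"
  shows "separable_set (A \<union> B)"
proof -
  obtain D E where "D \<subseteq> A" "countable D" "A \<subseteq> closure D" "E \<subseteq> B" "countable E" "B \<subseteq> closure E"
    using assms by (auto simp: separable_set_def)
  then show ?thesis unfolding separable_set_def by (intro exI[of _ "D \<union> E"]) (auto simp: closure_Un)
qed

lemma separable_interval_trans:
  fixes x :: "'a::linorder_topology"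
  assumes "separable_set {x..y}" "separable_set {y..z}"
  shows "separable_set {x..z}"
proof -
  consider "y < x" | "z < y" | "x \<le> y" "y \<le> z" by force
  then show ?thesis
  proof cases
    case 3
    then have "{x..z} = {x..y} \<union> {y..z}" by auto
    then show ?thesis using separable_set_Un[OF assms] by simp
  qed (rule separable_interval[OF assms(2)] separable_interval[OF assms(1)], force)+
qed

text \<open>For distinct points one of the two intervals is empty, so the conjunction expresses
  separability of the interval between them without asking which is smaller.\<close>

definition sep_equiv :: "'a::linorder_topology \<Rightarrow> 'a \<Rightarrow> bool" where
  "sep_equiv x y \<longleftrightarrow> separable_set {x..y} \<and> separable_set {y..x}"

lemma separable_interval_trivial: "y \<le> x \<Longrightarrow> separable_set {x::'a::linorder_topology..y}"
  unfolding separable_set_def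
  by (intro exI[of _ "{x..y}"]) (cases "x = y", auto simp: closure_subset countable_finite)

lemma sep_equiv_refl: "sep_equiv x x"
  unfolding sep_equiv_def by (intro conjI separable_interval_trivial order_refl)

lemma sep_equiv_sym: "sep_equiv x y \<Longrightarrow> sep_equiv y x"
  by (simp add: sep_equiv_def)

lemma sep_equiv_trans: "sep_equiv x y \<Longrightarrow> sep_equiv y z \<Longrightarrow> sep_equiv x z"
  unfolding sep_equiv_def by (meson separable_interval_trans)

lemma sep_equiv_le_iff: "x \<le> y \<Longrightarrow> sep_equiv x y \<longleftrightarrow> separable_set {x..y}"
  by (simp add: sep_equiv_def separable_interval_trivial)

lemma sep_equiv_between:
  assumes "sep_equiv x z" "x \<le> y" "y \<le> z"
  shows "sep_equiv x y"
  using assms separable_interval[of "{x..z}" x y] sep_equiv_le_iff[of x z] sep_equiv_le_iff[of x y]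
  by auto

lemma separable_adjacency_sep_equiv:
  assumes "separable_adjacency t"
  shows "\<exists>u. u \<noteq> t \<and> sep_equiv t u"
proof -
  obtain C x y where C: "t \<in> C" "separable_set C" "order_convex C" "x \<in> C" "y \<in> C" "x \<noteq> y"
    using assms by (auto simp: separable_adjacency_def)
  then obtain u where u: "u \<in> C" "u \<noteq> t" by metis
  have "{t..u} \<subseteq> C" "{u..t} \<subseteq> C" using C(1,3) u(1) by (auto simp: order_convex_def)
  with C(2) u(2) show ?thesis unfolding sep_equiv_def by (meson separable_interval)
qed

text \<open>Serves to apply the hypothesis on closed separable sets to \<open>H = {w..y}\<close>:
  restriction can make only the top end \<open>y\<close> newly right-isolated.\<close>

lemma right_isolated_in_interval:
  assumes "t \<in> right_isolated_in {w..y}" "w \<le> t" "t < y"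
  shows "right_isolated t"
proof -
  have "\<not> (\<forall>s\<in>{w..y}. s \<le> t)" using assms(2,3) by (auto intro!: bexI[of _ y] simp: not_le)
  then obtain s where s: "s \<in> {w..y}" "t < s" "{t<..<s} \<inter> {w..y} = {}"
    using assms(1) unfolding right_isolated_in_def by blast
  have "{t<..<s} \<subseteq> {t<..<s} \<inter> {w..y}" using s(1) assms(2) by auto
  with s(3) have "{t<..<s} = {}" by blast
  with s(2) show ?thesis by (auto simp: right_isolated_def)
qed

text \<open>Suprema and infima of a bounded function are approximated along countable sets, which
  replaces cofinal sequences in sets of uncountable cofinality.\<close>

lemma countable_exhausts_mono:
  fixes m :: "'a::linorder \<Rightarrow> real"
  assumes mono: "mono m" and bdd: "\<And>x. m x \<le> B" and X: "X \<noteq> {}"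
  shows "\<exists>Y. countable Y \<and> Y \<subseteq> X \<and> (\<forall>t s. (\<forall>y\<in>Y. y \<le> t) \<and> t \<le> s \<and> s \<in> X \<longrightarrow> m s = m t)"
proof -
  define c where "c = (SUP x\<in>X. m x)"
  have bd: "bdd_above (m ` X)" using bdd by (auto simp: bdd_above_def)
  have "\<exists>y\<in>X. c - inverse (Suc n) < m y" for n
    using less_cSUP_iff[OF X bd, of "c - inverse (Suc n)"] by (simp add: c_def)
  then obtain y where y: "\<And>n. y n \<in> X" "\<And>n. c - inverse (Suc n) < m (y n)" by metis
  have "m s = m t" if "\<forall>y\<in>range y. y \<le> t" "t \<le> s" "s \<in> X" for t s
  proof (rule antisym)
    have "c \<le> m t"
    proof (rule ccontr)
      assume "\<not> ?thesis"
      then obtain n where "inverse (Suc n) < c - m t" using reals_Archimedean[of "c - m t"] by auto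
      moreover have "m (y n) \<le> m t" using that mono by (auto dest: monoD)
      ultimately show False using y(2)[of n] by simp
    qed
    moreover have "m s \<le> c" unfolding c_def using bd that(3) by (rule cSUP_upper2) auto
    ultimately show "m s \<le> m t" by simp
    show "m t \<le> m s" using mono that(2) by (rule monoD)
  qed
  then show ?thesis using y(1) by (intro exI[of _ "range y"]) auto
qed

lemma countable_exhausts_mono_down:
  fixes m :: "'a::linorder \<Rightarrow> real"
  assumes mono: "mono m" and bdd: "\<And>x. 0 \<le> m x" and X: "X \<noteq> {}"
  shows "\<exists>Y. countable Y \<and> Y \<subseteq> X \<and> (\<forall>t s. (\<forall>y\<in>Y. t \<le> y) \<and> s \<le> t \<and> s \<in> X \<longrightarrow> m s = m t)"
proof -
  define c where "c = (INF x\<in>X. m x)"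
  have bd: "bdd_below (m ` X)" using bdd by (auto simp: bdd_below_def)
  have "\<exists>y\<in>X. m y < c + inverse (Suc n)" for n
    using cINF_less_iff[OF X bd, of "c + inverse (Suc n)"] by (simp add: c_def)
  then obtain y where y: "\<And>n. y n \<in> X" "\<And>n. m (y n) < c + inverse (Suc n)" by metis
  have "m s = m t" if "\<forall>y\<in>range y. t \<le> y" "s \<le> t" "s \<in> X" for t s
  proof (rule antisym)
    have "m t \<le> c"
    proof (rule ccontr)
      assume "\<not> ?thesis"
      then obtain n where "inverse (Suc n) < m t - c" using reals_Archimedean[of "m t - c"] by auto
      moreover have "m t \<le> m (y n)" using that mono by (auto dest: monoD)
      ultimately show False using y(2)[of n] by simp
    qed
    moreover have "c \<le> m s" unfolding c_def using bd that(3) by (rule cINF_lower)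
    ultimately show "m t \<le> m s" by simp
    show "m s \<le> m t" using mono that(2) by (rule monoD)
  qed
  then show ?thesis using y(1) by (intro exI[of _ "range y"]) auto
qed

section \<open>Tame sets of points\<close>

context weak_star_null_family
begin

text \<open>\<open>R\<close> marks the pairs whose value may have to go into the summable part. Each
  index has countably many marked points, and the unmarked values at a point form a null
  family.\<close>

definition tame :: "'a set \<Rightarrow> bool" where
  "tame S \<longleftrightarrow> (\<exists>R. (\<forall>i\<in>I. countable {t \<in> S. R i t}) \<and>
     (\<forall>t\<in>S. c0_family {i \<in> I. \<not> R i t} (\<lambda>i. F i t)))"

lemma tame_subset:
  assumes "tame S" "S' \<subseteq> S"
  shows "tame S'"
proof -
  obtain R where R: "\<And>i. i \<in> I \<Longrightarrow> countable {t \<in> S. R i t}"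
    "\<And>t. t \<in> S \<Longrightarrow> c0_family {i \<in> I. \<not> R i t} (\<lambda>i. F i t)"
    using assms(1) by (auto simp: tame_def)
  have "countable {t \<in> S'. R i t}" if "i \<in> I" for i
    using R(1)[OF that] by (rule countable_subset[rotated]) (use assms(2) in auto)
  with R(2) assms(2) show ?thesis by (auto simp: tame_def intro!: exI[of _ R])
qed

lemma tame_UN:
  assumes "countable N" "\<And>n. n \<in> N \<Longrightarrow> tame (S n)"
  shows "tame (\<Union>n\<in>N. S n)"
proof -
  have "\<forall>n\<in>N. \<exists>R. (\<forall>i\<in>I. countable {t \<in> S n. R i t}) \<and>
     (\<forall>t\<in>S n. c0_family {i \<in> I. \<not> R i t} (\<lambda>i. F i t))"
    using assms(2) by (simp add: tame_def)
  then obtain R where R: "\<And>n i. n \<in> N \<Longrightarrow> i \<in> I \<Longrightarrow> countable {t \<in> S n. R n i t}"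
    "\<And>n t. n \<in> N \<Longrightarrow> t \<in> S n \<Longrightarrow> c0_family {i \<in> I. \<not> R n i t} (\<lambda>i. F i t)" by metis
  have "\<forall>t\<in>\<Union>n\<in>N. S n. \<exists>n. n \<in> N \<and> t \<in> S n" by blast
  \<comment> \<open>Each point is assigned to one member of the union and inherits the marks of that
    member alone.\<close>
  then obtain n where n: "\<And>t. t \<in> (\<Union>n\<in>N. S n) \<Longrightarrow> n t \<in> N \<and> t \<in> S (n t)" by metis
  have "countable {t \<in> (\<Union>n\<in>N. S n). R (n t) i t}" if "i \<in> I" for i
  proof (rule countable_subset)
    show "{t \<in> (\<Union>n\<in>N. S n). R (n t) i t} \<subseteq> (\<Union>k\<in>N. {t \<in> S k. R k i t})" using n by blast
    show "countable (\<Union>k\<in>N. {t \<in> S k. R k i t})" using assms(1) R(1) that by auto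
  qed
  with R(2) n show ?thesis unfolding tame_def by (intro exI[of _ "\<lambda>i t. R (n t) i t"]) blast
qed

lemma tame_Un:
  assumes "tame S" "tame S'"
  shows "tame (S \<union> S')"
proof -
  have "tame (\<Union>b\<in>UNIV. if b then S else S')" by (rule tame_UN) (use assms in auto)
  then show ?thesis by (simp add: UNIV_bool Un_commute)
qed

lemma tame_countable:
  assumes "countable S"
  shows "tame S"
  unfolding tame_def
  by (intro exI[of _ "\<lambda>_ _. True"]) (use assms in \<open>auto simp: c0_family_def\<close>)

lemma countable_var_nonzero:
  assumes "i \<in> I" "disjoint_family_on U S" "\<And>t. t \<in> S \<Longrightarrow> U t \<in> sets borel"
  shows "countable {t \<in> S. var i (U t) \<noteq> 0}"
proof (rule countable_subset)
  show "{t \<in> S. var i (U t) \<noteq> 0} \<subseteq>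
      {t \<in> S. measure (M1 i) (U t) \<noteq> 0} \<union> {t \<in> S. measure (M2 i) (U t) \<noteq> 0}"
    by (auto simp: var_def)
  show "countable ({t \<in> S. measure (M1 i) (U t) \<noteq> 0} \<union> {t \<in> S. measure (M2 i) (U t) \<noteq> 0})"
    using assms by (intro countable_Un countable_disjoint_positive_measure finite_measure1 finite_measure2)
      (auto simp: sets1 sets2)
qed

text \<open>A pair is marked when \<open>F i t\<close> differs from the null family of
  \<open>g t\<close>. Then \<open>var i (U t)\<close> is positive, which for fixed \<open>i\<close>
  happens only countably often among disjoint sets.\<close>

lemma tame_disjoint:
  assumes U: "disjoint_family_on U S" "\<And>t. t \<in> S \<Longrightarrow> U t \<in> sets borel"
    and g: "\<And>t. t \<in> S \<Longrightarrow> continuous_on UNIV (g t)"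
    and near: "\<And>i t. i \<in> I \<Longrightarrow> t \<in> S \<Longrightarrow> \<bar>F i t - pair i (g t)\<bar> \<le> var i (U t)"
  shows "tame S"
  unfolding tame_def
proof (intro exI[of _ "\<lambda>i t. F i t \<noteq> pair i (g t)"] conjI ballI)
  fix i assume i: "i \<in> I"
  have "{t \<in> S. F i t \<noteq> pair i (g t)} \<subseteq> {t \<in> S. var i (U t) \<noteq> 0}"
    using near[OF i] by force
  then show "countable {t \<in> S. F i t \<noteq> pair i (g t)}"
    by (rule countable_subset) (rule countable_var_nonzero[OF i U])
next
  fix t assume t: "t \<in> S"
  have "c0_family {i \<in> I. \<not> F i t \<noteq> pair i (g t)} (\<lambda>i. pair i (g t))"
    by (rule c0_family_mono[OF pair_c0[OF g[OF t]]]) auto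
  then show "c0_family {i \<in> I. \<not> F i t \<noteq> pair i (g t)} (\<lambda>i. F i t)"
    by (subst c0_family_cong[of _ _ "\<lambda>i. pair i (g t)"]) auto
qed

lemma tame_left_discrete:
  assumes "\<And>t. t \<in> S \<Longrightarrow> \<exists>u<t. {u<..<t} \<inter> S = {}"
  shows "tame S"
proof -
  obtain u where u: "\<And>t. t \<in> S \<Longrightarrow> u t < t" "\<And>t. t \<in> S \<Longrightarrow> {u t<..<t} \<inter> S = {}"
    using assms by metis
  have le: "t \<le> u t'" if "t \<in> S" "t' \<in> S" "t < t'" for t t'
  proof (rule ccontr)
    assume "\<not> ?thesis"
    then have "t \<in> {u t'<..<t'} \<inter> S" using that by auto
    with u(2)[OF that(2)] show False by simp
  qed
  show ?thesis
  proof (rule tame_disjoint[of "\<lambda>t. {u t<..t}" S "\<lambda>t. step (u t) t"])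
    show "disjoint_family_on (\<lambda>t. {u t<..t}) S"
      unfolding disjoint_family_on_def
    proof (intro ballI impI)
      fix t t' assume "t \<in> S" "t' \<in> S" "t \<noteq> t'"
      then have "t \<le> u t' \<or> t' \<le> u t" using le by (metis linorder_neqE)
      then show "{u t<..t} \<inter> {u t'<..t'} = {}" by (elim disjE) fastforce+
    qed
  qed (use u in \<open>auto intro: step_continuous near_left\<close>)
qed

lemma tame_right_discrete:
  assumes "\<And>t. t \<in> S \<Longrightarrow> \<exists>u>t. {t<..<u} \<inter> S = {}"
  shows "tame S"
proof -
  obtain u where u: "\<And>t. t \<in> S \<Longrightarrow> t < u t" "\<And>t. t \<in> S \<Longrightarrow> {t<..<u t} \<inter> S = {}"
    using assms by metis
  have le: "u t \<le> t'" if "t \<in> S" "t' \<in> S" "t < t'" for t t'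
  proof (rule ccontr)
    assume "\<not> ?thesis"
    then have "t' \<in> {t<..<u t} \<inter> S" using that by auto
    with u(2)[OF that(1)] show False by simp
  qed
  show ?thesis
  proof (rule tame_disjoint[of "\<lambda>t. {t<..<u t}" S "\<lambda>t. step t (u t)"])
    show "disjoint_family_on (\<lambda>t. {t<..<u t}) S"
      unfolding disjoint_family_on_def
    proof (intro ballI impI)
      fix t t' assume "t \<in> S" "t' \<in> S" "t \<noteq> t'"
      then have "u t \<le> t' \<or> u t' \<le> t" using le by (metis linorder_neqE)
      then show "{t<..<u t} \<inter> {t'<..<u t'} = {}" by (elim disjE) fastforce+
    qed
  qed (use u in \<open>auto intro: step_continuous near_right\<close>)
qed

text \<open>An internal point of \<open>A\<close> that \<open>Der\<close> removes has a gap of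
  \<open>A\<close> on its left or on its right.\<close>

lemma tame_Diff_Der:
  assumes "S \<subseteq> A - Der A" "\<And>t. t \<in> S \<Longrightarrow> internal_pt t"
  shows "tame S"
proof -
  let ?L = "{t \<in> S. \<exists>u<t. {u<..<t} \<inter> A = {}}" and ?R = "{t \<in> S. \<exists>u>t. {t<..<u} \<inter> A = {}}"
  have "tame ?L" by (rule tame_left_discrete) (use assms(1) in blast)
  moreover have "tame ?R" by (rule tame_right_discrete) (use assms(1) in blast)
  moreover have "S \<subseteq> ?L \<union> ?R"
  proof
    fix t assume t: "t \<in> S"
    then have "\<not> is_min_pt t" "\<not> is_max_pt t"
      using assms(2) by (auto simp: internal_pt_def right_isolated_def left_isolated_def)
    with t assms(1) show "t \<in> ?L \<union> ?R" unfolding Der_def by blast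
  qed
  ultimately show ?thesis by (meson tame_Un tame_subset)
qed

lemma tame_finite_height:
  assumes "finite_two_sided_height A" "S \<subseteq> A" "\<And>t. t \<in> S \<Longrightarrow> internal_pt t"
  shows "tame S"
proof -
  obtain n where n: "(Der ^^ n) A = {}" using assms(1) by (auto simp: finite_two_sided_height_def)
  let ?S = "\<lambda>k. S \<inter> ((Der ^^ k) A - (Der ^^ Suc k) A)"
  have "tame (\<Union>k. ?S k)"
    using assms(3) by (intro tame_UN tame_Diff_Der[where A="(Der ^^ _) A"]) auto
  moreover have "t \<in> (\<Union>k. ?S k)" if t: "t \<in> S" for t
  proof -
    \<comment> \<open>The first stage that omits \<open>t\<close> is not stage \<open>0\<close>, as
      \<open>S \<subseteq> A\<close>; so \<open>t\<close> lies in the difference just before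
      it.\<close>
    define k where "k = (LEAST k. t \<notin> (Der ^^ k) A)"
    have k: "t \<notin> (Der ^^ k) A" unfolding k_def using n by (intro LeastI[of "\<lambda>k. t \<notin> (Der ^^ k) A" n]) simp
    moreover have "k \<noteq> 0" using k t assms(2) by (metis funpow_0 subsetD)
    then obtain j where j: "k = Suc j" by (cases k) auto
    have "t \<in> (Der ^^ j) A" using not_less_Least[of j "\<lambda>k. t \<notin> (Der ^^ k) A"] j by (auto simp: k_def)
    ultimately show ?thesis using t j by auto
  qed
  ultimately show ?thesis by (meson subsetI tame_subset)
qed

lemma tame_left_isolated:
  assumes "\<And>t. t \<in> S \<Longrightarrow> left_isolated t"
  shows "tame S"
proof -
  have "tame {t \<in> S. \<not> is_min_pt t}"
    by (rule tame_left_discrete) (use assms in \<open>fastforce simp: left_isolated_def\<close>)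
  moreover have "tame {t \<in> S. is_min_pt t}"
  proof (rule tame_countable)
    have "t = t'" if "is_min_pt t" "is_min_pt t'" for t t' :: 'a
      using that by (auto simp: is_min_pt_def intro: antisym)
    then have "{t \<in> S. is_min_pt t} \<subseteq> {SOME t. is_min_pt t}" by (auto intro: someI)
    then show "countable {t \<in> S. is_min_pt t}" by (rule countable_subset) simp
  qed
  ultimately have "tame ({t \<in> S. \<not> is_min_pt t} \<union> {t \<in> S. is_min_pt t})" by (rule tame_Un)
  then show ?thesis by (rule tame_subset) auto
qed

text \<open>Each point is the maximum of its class, and the class reaches down to some
  \<open>u < t\<close>. A class has only one maximum, so no other point of \<open>S\<close> lies in
  between.\<close>

lemma tame_sep_equiv_maximal:
  assumes "\<And>t. t \<in> S \<Longrightarrow> \<exists>u<t. sep_equiv t u" "\<And>t s. t \<in> S \<Longrightarrow> t < s \<Longrightarrow> \<not> sep_equiv t s"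
  shows "tame S"
proof (rule tame_left_discrete)
  fix t assume t: "t \<in> S"
  then obtain u where u: "u < t" "sep_equiv t u" using assms(1) by blast
  have "z \<notin> S" if "z \<in> {u<..<t}" for z
  proof
    assume "z \<in> S"
    have "sep_equiv u z" using sep_equiv_between[OF sep_equiv_sym[OF u(2)], of z] that by auto
    then have "sep_equiv z t" using u(2) sep_equiv_sym sep_equiv_trans by blast
    with assms(2)[OF \<open>z \<in> S\<close>] that show False by auto
  qed
  then show "\<exists>u<t. {u<..<t} \<inter> S = {}" using u(1) by blast
qed

end

section \<open>Points whose class continues above them\<close>

text \<open>If the infimum is not attained, it cannot be right-isolated, since an immediate
  successor would be a larger lower bound. A countable set descending to it then yields points of
  \<open>X\<close> below each of its members.\<close>

lemma countable_coinitial: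
  fixes X :: "'a::linorder set"
  assumes p: "is_glb X p" and X: "X \<noteq> {}" and char: "p \<in> X \<or> countable_right_char p"
  shows "\<exists>W. countable W \<and> W \<subseteq> X \<and> (\<forall>t\<in>X. \<exists>w\<in>W. w \<le> t)"
proof (cases "p \<in> X")
  case True
  then show ?thesis using p by (intro exI[of _ "{p}"]) (auto simp: is_glb_def)
next
  case False
  have less: "p < x" if "x \<in> X" for x using p that False unfolding is_glb_def by (metis order.not_eq_order_implies_strict)
  have "\<not> right_isolated p"
  proof
    assume "right_isolated p"
    moreover have "\<not> is_max_pt p" using X less by (auto simp: is_max_pt_def not_le)
    ultimately obtain s where s: "p < s" "{p<..<s} = {}" by (auto simp: right_isolated_def)
    have "s \<le> x" if "x \<in> X" for x
    proof (rule ccontr)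
      assume "\<not> s \<le> x"
      then have "x \<in> {p<..<s}" using less[OF that] by simp
      with s(2) show False by simp
    qed
    with p have "s \<le> p" by (simp add: is_glb_def)
    with s(1) show False by simp
  qed
  with char False obtain A where A: "countable A" "A \<subseteq> {p<..}" "is_glb A p"
    by (auto simp: countable_right_char_def)
  have "\<exists>x\<in>X. x < a" if "a \<in> A" for a
    using p A(2) that unfolding is_glb_def by (meson greaterThan_iff not_le subsetD)
  then obtain x where x: "\<And>a. a \<in> A \<Longrightarrow> x a \<in> X" "\<And>a. a \<in> A \<Longrightarrow> x a < a" by metis
  have "\<exists>w\<in>x ` A. w \<le> t" if "t \<in> X" for t
  proof -
    have "\<not> t \<le> p" using less[OF that] by simp
    then obtain a where "a \<in> A" "a < t" using A(3) unfolding is_glb_def by (meson not_le)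
    then show ?thesis using x(2) by (intro bexI[of _ "x a"]) (auto intro: less_imp_le less_trans)
  qed
  then show ?thesis using A(1) x(1) by (intro exI[of _ "x ` A"]) auto
qed

context weak_star_null_family
begin

lemma var_atMost_diff:
  assumes "i \<in> I" "s \<le> t"
  shows "var i {..t} = var i {..s} + var i {s<..t}"
proof -
  have "{..t} = {..s} \<union> {s<..t}" using assms(2) by auto
  moreover have "{..s} \<inter> {s<..t} = {}" by auto
  ultimately show ?thesis using var_Un[OF assms(1), of "{..s}" "{s<..t}"]
    by (simp add: greaterThanAtMost_borel)
qed

text \<open>For fixed \<open>i\<close>, marked points meet countably many classes, because each
  gives positive \<open>var i\<close> inside its class. Within a class they lie between countably
  many lower and upper bounds, and \<open>sep\<close> counts those in each separable
  interval.\<close>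

lemma tame_sep_equiv:
  assumes sep: "\<And>w y. separable_set {w..y} \<Longrightarrow> countable {t \<in> S. w \<le> t \<and> t < y}"
    and ex: "\<And>t. t \<in> S \<Longrightarrow> \<exists>s>t. sep_equiv t s"
  shows "tame S"
proof -
  obtain s where s: "\<And>t. t \<in> S \<Longrightarrow> t < s t" "\<And>t. t \<in> S \<Longrightarrow> sep_equiv t (s t)"
    using ex by metis
  define cls where "cls t = {z. sep_equiv t z}" for t :: 'a
  have cls_eq: "cls t = cls z" if "sep_equiv t z" for t z
    unfolding cls_def using that sep_equiv_sym sep_equiv_trans by blast
  define p where "p t = (SOME p. is_glb (cls t) p)" for t
  have p: "is_glb (cls t) (p t)" for t
    unfolding p_def by (rule someI_ex, rule compact_imp_glb[OF compact_UNIV])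
      (use sep_equiv_refl in \<open>auto simp: cls_def\<close>)
  \<comment> \<open>The second clause is the correction at the lower end: if \<open>p t\<close> has
    uncountable right character, \<open>F i (p t)\<close> is null, so the points where
    \<open>F i t\<close> agrees with it stay unmarked.\<close>
  define R where "R i t \<longleftrightarrow> F i t \<noteq> pair i (step t (s t)) \<and>
    (countable_right_char (p t) \<or> F i t \<noteq> F i (p t))" for i t
  have c0: "c0_family {i \<in> I. \<not> R i t} (\<lambda>i. F i t)" if t: "t \<in> S" for t
  proof -
    let ?A = "{i \<in> I. F i t = pair i (step t (s t))}"
      and ?B = "{i \<in> I. \<not> countable_right_char (p t) \<and> F i t = F i (p t)}"
    have "c0_family ?A (\<lambda>i. pair i (step t (s t)))"
      by (rule c0_family_mono[OF pair_c0[OF step_continuous[OF s(1)[OF t]]]]) auto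
    then have A: "c0_family ?A (\<lambda>i. F i t)"
      by (subst c0_family_cong[of _ _ "\<lambda>i. pair i (step t (s t))"]) auto
    have B: "c0_family ?B (\<lambda>i. F i t)"
    proof (cases "countable_right_char (p t)")
      case True
      then show ?thesis by (simp add: c0_family_def)
    next
      case False
      then have "c0_family ?B (\<lambda>i. F i (p t))"
        by (intro c0_family_mono[OF uncountable_right_char_c0]) auto
      then show ?thesis by (subst c0_family_cong[of _ _ "\<lambda>i. F i (p t)"]) auto
    qed
    show ?thesis by (rule c0_family_mono[OF c0_family_Un[OF A B]]) (auto simp: R_def)
  qed
  have cnt: "countable {t \<in> S. R i t}" if i: "i \<in> I" for i
  proof -
    define Z where "Z = {t \<in> S. R i t}"
    have ZS: "t \<in> S" if "t \<in> Z" for t using that by (simp add: Z_def)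
    have pos: "var i {t<..<s t} > 0" if "t \<in> Z" for t
      using near_right[OF i s(1)[OF ZS[OF that]]] that var_nonneg[of i "{t<..<s t}"]
      by (auto simp: Z_def R_def)
    have "\<forall>X\<in>cls ` Z. \<exists>t\<in>Z. cls t = X" by auto
    then obtain r where r: "\<And>X. X \<in> cls ` Z \<Longrightarrow> r X \<in> Z" "\<And>X. X \<in> cls ` Z \<Longrightarrow> cls (r X) = X"
      by metis
    \<comment> \<open>Classes are convex, so the interval at a representative stays inside its
      class.\<close>
    have "disjoint_family_on (\<lambda>X. {r X<..<s (r X)}) (cls ` Z)"
      unfolding disjoint_family_on_def
    proof (intro ballI impI, rule ccontr)
      fix X Y assume XY: "X \<in> cls ` Z" "Y \<in> cls ` Z" "X \<noteq> Y"
      assume "{r X<..<s (r X)} \<inter> {r Y<..<s (r Y)} \<noteq> {}"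
      then obtain z where z: "r X < z" "z < s (r X)" "r Y < z" "z < s (r Y)" by auto
      have "sep_equiv (r X) z" "sep_equiv (r Y) z"
        using z XY by (auto intro!: sep_equiv_between[OF s(2)] ZS r(1))
      then have "X = Y" using cls_eq r(2) XY by metis
      with XY(3) show False ..
    qed
    from countable_var_nonzero[OF i this]
    have "countable {X \<in> cls ` Z. var i {r X<..<s (r X)} \<noteq> 0}" by simp
    moreover have "var i {r X<..<s (r X)} \<noteq> 0" if "X \<in> cls ` Z" for X
      using pos[OF r(1)[OF that]] by simp
    then have "cls ` Z \<subseteq> {X \<in> cls ` Z. var i {r X<..<s (r X)} \<noteq> 0}" by blast
    ultimately have 1: "countable (cls ` Z)" by (rule countable_subset[rotated])
    have 2: "countable {t \<in> Z. cls t = X}" if X: "X \<in> cls ` Z" for X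
    proof -
      define q where "q = p (r X)"
      have q: "is_glb X q" using p[of "r X"] r(2)[OF X] by (simp add: q_def)
      have pq: "p t = q" if "cls t = X" for t using that r(2)[OF X] by (simp add: q_def p_def)
      have equiv: "sep_equiv x y" if "x \<in> X" "y \<in> X" for x y
      proof -
        have "sep_equiv (r X) x" "sep_equiv (r X) y" using that r(2)[OF X] by (auto simp: cls_def)
        then show ?thesis using sep_equiv_sym sep_equiv_trans by blast
      qed
      have mem: "t \<in> X" if "cls t = X" for t using that sep_equiv_refl by (auto simp: cls_def)
      have ne: "X \<noteq> {}" using mem[OF r(2)[OF X]] by auto
      have mono: "mono (\<lambda>x. var i {..x})" by (intro monoI var_mono i) auto
      have bd: "var i {..x} \<le> var i UNIV" for x by (intro var_mono i) auto
      \<comment> \<open>Inside \<open>X\<close>, \<open>var i\<close> is exhausted above all of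
        \<open>Y\<close> and below all of \<open>W\<close>. The set \<open>W'\<close> is coinitial
        in \<open>X\<close> whenever the infimum \<open>q\<close> permits a countable one.\<close>
      from countable_exhausts_mono[OF mono bd ne] obtain Y where Y: "countable Y" "Y \<subseteq> X"
        "\<forall>t s. (\<forall>y\<in>Y. y \<le> t) \<and> t \<le> s \<and> s \<in> X \<longrightarrow> var i {..s} = var i {..t}"
        by (elim exE conjE) (rule that)
      from countable_exhausts_mono_down[OF mono var_nonneg ne] obtain W where W: "countable W" "W \<subseteq> X"
        "\<forall>t s. (\<forall>y\<in>W. t \<le> y) \<and> s \<le> t \<and> s \<in> X \<longrightarrow> var i {..s} = var i {..t}"
        by (elim exE conjE) (rule that)
      have "\<exists>W'. countable W' \<and> W' \<subseteq> X \<and>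
        (q \<in> X \<or> countable_right_char q \<longrightarrow> (\<forall>t\<in>X. \<exists>w\<in>W'. w \<le> t))"
        using countable_coinitial[OF q ne] by (cases "q \<in> X \<or> countable_right_char q") (blast, auto)
      then obtain W' where W': "countable W'" "W' \<subseteq> X"
        "q \<in> X \<or> countable_right_char q \<Longrightarrow> (\<forall>t\<in>X. \<exists>w\<in>W'. w \<le> t)" by blast
      have "{t \<in> Z. cls t = X} \<subseteq> (\<Union>w\<in>W \<union> W'. \<Union>y\<in>Y. {t \<in> S. w \<le> t \<and> t < y})"
      proof
        fix t assume "t \<in> {t \<in> Z. cls t = X}"
        then have t: "t \<in> Z" "cls t = X" by auto
        have tX: "t \<in> X" by (rule mem[OF t(2)])
        have st: "t < s t" by (rule s(1)[OF ZS[OF t(1)]])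
        \<comment> \<open>Otherwise nothing of \<open>var i\<close> would remain between
          \<open>t\<close> and \<open>s t\<close>, which belongs to \<open>X\<close>, contrary to
          \<open>pos\<close>.\<close>
        have "\<exists>y\<in>Y. t < y"
        proof (rule ccontr)
          assume "\<not> ?thesis"
          then have "\<forall>y\<in>Y. y \<le> t" by (simp add: not_less)
          moreover have "s t \<in> X" using s(2)[OF ZS[OF t(1)]] t(2) by (auto simp: cls_def)
          ultimately have "var i {..s t} = var i {..t}" using Y(3) st by (simp add: less_imp_le)
          then have "var i {t<..s t} = 0" using var_atMost_diff[OF i, of t "s t"] st by simp
          moreover have "var i {t<..<s t} \<le> var i {t<..s t}"
            by (intro var_mono i greaterThanAtMost_borel) auto
          ultimately show False using pos[OF t(1)] by simp
        qed
        moreover have "\<exists>w\<in>W \<union> W'. w \<le> t"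
        proof (rule ccontr)
          assume no: "\<not> ?thesis"
          then have nq: "q \<notin> X" "\<not> countable_right_char q" using W'(3) tX by blast+
          have Wt: "\<forall>y\<in>W. t \<le> y" using no by (auto simp: not_le less_imp_le)
          \<comment> \<open>Below \<open>t\<close> no variation is left inside \<open>X\<close>, and
            near \<open>q\<close> right continuity makes it small. So \<open>F i t = F i q\<close>,
            which \<open>R\<close> excludes.\<close>
          have "\<bar>F i t - F i q\<bar> \<le> 1 * d" if d: "d > 0" for d
          proof -
            have "\<not> is_max_pt q" using nq(2) by (auto simp: countable_right_char_def right_isolated_def)
            from var_right_continuous[OF i this d] obtain c where c: "q < c" "var i {q<..<c} \<le> d"
              by blast
            obtain x where x: "x \<in> X" "x < c" using q c(1) unfolding is_glb_def by (meson not_le)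
            \<comment> \<open>The minimum keeps the point in \<open>X\<close>, below
              \<open>c\<close> and not above \<open>t\<close>.\<close>
            define x' where "x' = min x t"
            have x': "x' \<in> X" "x' < c" "x' \<le> t" using x tX by (auto simp: x'_def min_def)
            have "q \<le> x'" "q \<le> t" using q x'(1) tX by (auto simp: is_glb_def)
            have "{q<..t} = {q<..x'} \<union> {x'<..t}" using \<open>q \<le> x'\<close> x'(3) by auto
            then have "var i {q<..t} = var i {q<..x'} + var i {x'<..t}"
              using var_Un[OF i, of "{q<..x'}" "{x'<..t}"] by (auto simp: greaterThanAtMost_borel)
            moreover have "var i {x'<..t} = 0"
              using W(3) Wt x'(1,3) var_atMost_diff[OF i x'(3)] by simp
            moreover have "var i {q<..x'} \<le> var i {q<..<c}" using x'(2) by (intro var_mono i) auto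
            ultimately show ?thesis using F_diff_le_var[OF i \<open>q \<le> t\<close>] c(2) by simp
          qed
          from abs_le_all_imp_zero[OF this] have "F i t = F i q" by simp
          with nq(2) t show False by (auto simp: Z_def R_def pq)
        qed
        ultimately show "t \<in> (\<Union>w\<in>W \<union> W'. \<Union>y\<in>Y. {t \<in> S. w \<le> t \<and> t < y})"
          using ZS[OF t(1)] by blast
      qed
      moreover have "countable (\<Union>w\<in>W \<union> W'. \<Union>y\<in>Y. {t \<in> S. w \<le> t \<and> t < y})"
      proof (intro countable_UN countable_Un W(1) W'(1) Y(1) sep)
        fix w y assume "w \<in> W \<union> W'" "y \<in> Y"
        then have "sep_equiv w y" using equiv W(2) W'(2) Y(2) by blast
        then show "separable_set {w..y}" by (simp add: sep_equiv_def)
      qed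
      ultimately show ?thesis by (rule countable_subset)
    qed
    have "Z = (\<Union>X\<in>cls ` Z. {t \<in> Z. cls t = X})" by auto
    also have "countable \<dots>" using 1 2 by (rule countable_UN)
    finally show ?thesis by (simp add: Z_def)
  qed
  show ?thesis unfolding tame_def using c0 cnt by blast
qed

section \<open>Decomposition on countable blocks and gluing\<close>

text \<open>The points are exhausted by finite sets \<open>Xn n\<close>. Each index works at a stage
  \<open>n i\<close> that tends to infinity along \<open>J\<close>: on \<open>Xn (n i)\<close> the
  pairing with the step is the null part and the rest is \<open>b\<close>, summed by
  \<open>sum_step_bound\<close>.\<close>

lemma countable_block:
  assumes C: "\<forall>i\<in>I. \<forall>f. continuous_on UNIV f \<and> (\<forall>z. \<bar>f z\<bar> \<le> 1) \<longrightarrow> \<bar>pair i f\<bar> \<le> C"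
    and J: "J \<subseteq> I" "countable J" and X: "countable X" "\<And>t. t \<in> X \<Longrightarrow> \<not> is_max_pt t"
    and C0: "0 \<le> C"
  shows "\<exists>b. (\<forall>t\<in>X. c0_family J (\<lambda>i. F i t - b i t)) \<and>
    (\<forall>i\<in>J. \<forall>Y. Y \<subseteq> X \<and> finite Y \<longrightarrow> (\<Sum>t\<in>Y. \<bar>b i t\<bar>) \<le> C)"
proof -
  define Xn where "Xn n = X \<inter> from_nat_into X ` {..<n}" for n
  have fin: "finite (Xn n)" for n by (simp add: Xn_def)
  have XnX: "Xn n \<subseteq> X" for n by (simp add: Xn_def)
  have ex: "\<exists>s>t. \<forall>t'\<in>Xn n. t < t' \<longrightarrow> s \<le> t'" if t: "t \<in> Xn n" for n t
  proof (cases "{t' \<in> Xn n. t < t'} = {}")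
    case True
    obtain s where "t < s" using X(2)[of t] XnX t by (auto simp: is_max_pt_def not_le)
    then show ?thesis using True by blast
  next
    case False
    have "finite {t' \<in> Xn n. t < t'}" using fin by simp
    then show ?thesis using Min_in[OF _ False] Min_le
      by (intro exI[of _ "Min {t' \<in> Xn n. t < t'}"]) auto
  qed
  define s where "s n t = (SOME s. t < s \<and> (\<forall>t'\<in>Xn n. t < t' \<longrightarrow> s \<le> t'))" for n t
  have s: "t < s n t" "\<forall>t'\<in>Xn n. t < t' \<longrightarrow> s n t \<le> t'" if "t \<in> Xn n" for n t
    using someI_ex[OF ex[OF that]] unfolding s_def by blast+
  \<comment> \<open>The finitely many indices for which the null part at stage \<open>n\<close> is
    not yet small.\<close>
  define E where "E n = {i \<in> J. \<exists>t\<in>Xn n. inverse (Suc n) \<le> \<bar>pair i (step t (s n t))\<bar>}" for n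
  have finE: "finite (E n)" for n
  proof (rule finite_subset)
    show "E n \<subseteq> (\<Union>t\<in>Xn n. {i \<in> I. inverse (Suc n) \<le> \<bar>pair i (step t (s n t))\<bar>})"
      using J(1) by (auto simp: E_def)
    show "finite (\<Union>t\<in>Xn n. {i \<in> I. inverse (Suc n) \<le> \<bar>pair i (step t (s n t))\<bar>})"
    proof (intro finite_UN_I fin)
      fix t assume "t \<in> Xn n"
      from pair_c0[OF step_continuous[OF s(1)[OF this]]]
      show "finite {i \<in> I. inverse (Suc n) \<le> \<bar>pair i (step t (s n t))\<bar>}"
        using inverse_Suc[of n] unfolding c0_family_def by blast
    qed
  qed
  define N where "N = to_nat_on J"
  define M where "M i = {n. n \<le> N i \<and> i \<notin> E n}" for i
  \<comment> \<open>The last stage up to the number of \<open>i\<close> at which \<open>i\<close> is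
    not exceptional. Stage \<open>0\<close> always qualifies, since \<open>Xn 0\<close> is
    empty.\<close>
  define n where "n i = Max (M i)" for i
  have finM: "finite (M i)" for i by (rule finite_subset[of _ "{..N i}"]) (auto simp: M_def)
  have "0 \<in> M i" for i by (auto simp: M_def E_def Xn_def)
  then have nM: "n i \<in> M i" for i unfolding n_def using Max_in[OF finM] by blast
  define b where "b i t = (if t \<in> Xn (n i) then F i t - pair i (step t (s (n i) t)) else 0)" for i t
  have "c0_family J (\<lambda>i. F i t - b i t)" if t: "t \<in> X" for t
  proof (rule c0_familyI)
    fix e :: real assume e: "e > 0"
    obtain k where k: "t = from_nat_into X k" using X(1) t by (metis from_nat_into_surj)
    obtain l where l: "inverse (real (Suc l)) < e" using reals_Archimedean[OF e] ..
    \<comment> \<open>From stage \<open>Suc k\<close> on \<open>t\<close> belongs to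
      \<open>Xn\<close>, and from stage \<open>l\<close> on the error is below \<open>e\<close>. The
      stage \<open>n i\<close> reaches \<open>m\<close> unless \<open>N i < m\<close> or
      \<open>i \<in> E m\<close>.\<close>
    define m where "m = max (Suc k) l"
    have "inverse (real (Suc m)) \<le> inverse (real (Suc l))"
      by (rule le_imp_inverse_le) (simp_all add: m_def)
    then have m: "inverse (real (Suc m)) < e" using l by (rule le_less_trans)
    have "{i \<in> J. e \<le> \<bar>F i t - b i t\<bar>} \<subseteq> {i \<in> J. N i < m} \<union> E m"
    proof (rule subsetI, rule ccontr)
      fix i assume i: "i \<in> {i \<in> J. e \<le> \<bar>F i t - b i t\<bar>}" "i \<notin> {i \<in> J. N i < m} \<union> E m"
      then have "m \<in> M i" by (auto simp: M_def)
      then have mn: "m \<le> n i" unfolding n_def by (rule Max_ge[OF finM])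
      then have tX: "t \<in> Xn (n i)" using t k by (auto simp: Xn_def m_def)
      have "i \<notin> E (n i)" using nM[of i] by (simp add: M_def)
      then have "\<bar>pair i (step t (s (n i) t))\<bar> < inverse (real (Suc (n i)))"
        using i(1) tX by (auto simp: E_def not_le)
      also have "\<dots> \<le> inverse (real (Suc m))" using mn by (intro le_imp_inverse_le) simp_all
      also note m
      finally show False using i(1) tX by (simp add: b_def)
    qed
    moreover have "finite {i \<in> J. N i < m}"
    proof (rule finite_imageD[of N])
      show "finite (N ` {i \<in> J. N i < m})" by (rule finite_subset[of _ "{..<m}"]) auto
      show "inj_on N {i \<in> J. N i < m}"
        unfolding N_def by (rule inj_on_subset[OF inj_on_to_nat_on[OF J(2)]]) auto
    qed
    ultimately show "finite {i \<in> J. e \<le> \<bar>F i t - b i t\<bar>}"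
      using finE by (meson finite_Un finite_subset)
  qed
  moreover have "(\<Sum>t\<in>Y. \<bar>b i t\<bar>) \<le> C" if i: "i \<in> J" and Y: "Y \<subseteq> X" "finite Y" for i Y
  proof -
    have "(\<Sum>t\<in>Y. \<bar>b i t\<bar>) = (\<Sum>t\<in>Y \<inter> Xn (n i). \<bar>F i t - pair i (step t (s (n i) t))\<bar>)"
      using Y(2) by (intro sum.mono_neutral_cong_right) (auto simp: b_def)
    also have "\<dots> \<le> C" using i J(1) C Y(2) s by (intro sum_step_bound) auto
    finally show ?thesis .
  qed
  ultimately show ?thesis by blast
qed

text \<open>Uncountable index sets are handled by a bipartite graph between indices and points: since
  all its vertices have countable degree, its components are countable, and outside of the diagonal
  blocks given by the components the family is null at each point.\<close>

lemma tame_imp_type_c0l1: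
  assumes S: "tame S" "\<And>t. t \<in> S \<Longrightarrow> countable_right_char t" "\<And>t. t \<in> S \<Longrightarrow> \<not> right_isolated t"
  shows "type_c0l1 I F S"
proof -
  obtain C where C: "0 \<le> C"
    "\<forall>i\<in>I. \<forall>f. continuous_on UNIV f \<and> (\<forall>z. \<bar>f z\<bar> \<le> 1) \<longrightarrow> \<bar>pair i f\<bar> \<le> C"
    using uniform_bound by blast
  obtain R where R: "\<And>i. i \<in> I \<Longrightarrow> countable {t \<in> S. R i t}"
    "\<And>t. t \<in> S \<Longrightarrow> c0_family {i \<in> I. \<not> R i t} (\<lambda>i. F i t)"
    using S(1) by (auto simp: tame_def)
  \<comment> \<open>Requiring \<open>F i t \<noteq> 0\<close> makes the degree of a point countable,
    by \<open>countable_support\<close>; the marks \<open>R\<close> do so for an index.\<close>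
  define E where "E i t \<longleftrightarrow> i \<in> I \<and> t \<in> S \<and> R i t \<and> F i t \<noteq> 0" for i t
  have E1: "countable {t. E i t}" for i
  proof (cases "i \<in> I")
    case True
    show ?thesis by (rule countable_subset[OF _ R(1)[OF True]]) (auto simp: E_def)
  qed (simp add: E_def)
  have E2: "countable {i. E i t}" for t
  proof (cases "t \<in> S")
    case True
    show ?thesis by (rule countable_subset[OF _ countable_support[OF S(2,3)[OF True]]]) (auto simp: E_def)
  qed (simp add: E_def)
  define G where "G = {(t, t'). \<exists>i. E i t \<and> E i t'}"
  have symG: "(t', t) \<in> G\<^sup>*" if "(t, t') \<in> G\<^sup>*" for t t'
  proof -
    have "sym G" by (auto simp: sym_def G_def)
    then show ?thesis using that by (meson sym_rtrancl symD)
  qed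
  \<comment> \<open>\<open>K t\<close> and \<open>J t\<close> are the points and the indices of the
    component of \<open>t\<close>.\<close>
  define K where "K t = G\<^sup>* `` {t}" for t
  define J where "J t = {i. \<exists>t'\<in>K t. E i t'}" for t
  have K_eq: "K t = K t'" if "(t, t') \<in> G\<^sup>*" for t t'
    using that symG[OF that] by (auto simp: K_def intro: rtrancl_trans)
  have "countable (G `` Y)" if "countable Y" for Y
  proof (rule countable_subset)
    show "G `` Y \<subseteq> (\<Union>t\<in>Y. \<Union>i\<in>{i. E i t}. {t'. E i t'})" by (auto simp: G_def)
    show "countable (\<Union>t\<in>Y. \<Union>i\<in>{i. E i t}. {t'. E i t'})"
      by (intro countable_UN that E1 E2)
  qed
  then have K_cnt: "countable (K t)" for t unfolding K_def by (rule countable_rtrancl) simp_all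
  have J_eq: "J t = (\<Union>t'\<in>K t. {i. E i t'})" for t by (auto simp: J_def)
  have J_cnt: "countable (J t)" for t unfolding J_eq by (intro countable_UN K_cnt E2)
  have JI: "J t \<subseteq> I" for t by (auto simp: J_def E_def)
  have KS: "K t \<subseteq> S" if "t \<in> S" for t
  proof
    fix u assume "u \<in> K t"
    then have "(t, u) \<in> G\<^sup>*" by (simp add: K_def)
    then show "u \<in> S" by (induction rule: rtrancl_induct) (auto simp: that G_def E_def)
  qed
  have tK: "t \<in> K t" for t by (simp add: K_def)
  \<comment> \<open>The choice depends on the component only as a set, so all its points share one
    decomposition.\<close>
  define b where "b X = (SOME b. (\<forall>t\<in>X. c0_family {i. \<exists>t'\<in>X. E i t'} (\<lambda>i. F i t - b i t)) \<and>
    (\<forall>i\<in>{i. \<exists>t'\<in>X. E i t'}. \<forall>Y. Y \<subseteq> X \<and> finite Y \<longrightarrow> (\<Sum>t\<in>Y. \<bar>b i t\<bar>) \<le> C))" for X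
  have b: "(\<forall>t'\<in>K t. c0_family (J t) (\<lambda>i. F i t' - b (K t) i t')) \<and>
    (\<forall>i\<in>J t. \<forall>Y. Y \<subseteq> K t \<and> finite Y \<longrightarrow> (\<Sum>t'\<in>Y. \<bar>b (K t) i t'\<bar>) \<le> C)" if t: "t \<in> S" for t
  proof -
    have "\<not> is_max_pt u" if "u \<in> K t" for u
      using S(3)[of u] KS[OF t] that by (auto simp: right_isolated_def)
    then have "\<exists>b. (\<forall>t'\<in>K t. c0_family (J t) (\<lambda>i. F i t' - b i t')) \<and>
      (\<forall>i\<in>J t. \<forall>Y. Y \<subseteq> K t \<and> finite Y \<longrightarrow> (\<Sum>t'\<in>Y. \<bar>b i t'\<bar>) \<le> C)"
      by (rule countable_block[OF C(2) JI J_cnt K_cnt _ C(1)])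
    from someI_ex[OF this] show ?thesis unfolding b_def J_def .
  qed
  define B where "B i t = (if i \<in> J t then b (K t) i t else 0)" for i t
  have null_part: "c0_family I (\<lambda>i. F i t - B i t)" if t: "t \<in> S" for t
  proof -
    have "c0_family (J t) (\<lambda>i. F i t - b (K t) i t)" using b[OF t] tK by blast
    then have 1: "c0_family (J t) (\<lambda>i. F i t - B i t)"
      by (subst c0_family_cong[of _ _ "\<lambda>i. F i t - b (K t) i t"]) (auto simp: B_def)
    \<comment> \<open>An index outside \<open>J t\<close> is unmarked at \<open>t\<close> or has
      value \<open>0\<close> there.\<close>
    have "c0_family {i \<in> I. F i t = 0} (\<lambda>i. F i t)"
      using c0_family_zero by (subst c0_family_cong[of _ _ "\<lambda>_. 0"]) auto
    from c0_family_Un[OF R(2)[OF t] this]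
    have "c0_family (I - J t) (\<lambda>i. F i t)"
      by (rule c0_family_mono) (use t tK in \<open>auto simp: J_def E_def\<close>)
    then have 2: "c0_family (I - J t) (\<lambda>i. F i t - B i t)"
      by (subst c0_family_cong[of _ _ "\<lambda>i. F i t"]) (auto simp: B_def)
    show ?thesis by (rule c0_family_mono[OF c0_family_Un[OF 1 2]]) auto
  qed
  have sum_part: "(\<Sum>t\<in>Y. \<bar>B i t\<bar>) \<le> C" if i: "i \<in> I" and Y: "Y \<subseteq> S" "finite Y" for i Y
  proof -
    define Y' where "Y' = {t \<in> Y. i \<in> J t}"
    have sum: "(\<Sum>t\<in>Y. \<bar>B i t\<bar>) = (\<Sum>t\<in>Y'. \<bar>b (K t) i t\<bar>)"
      using Y(2) by (intro sum.mono_neutral_cong_right) (auto simp: B_def Y'_def)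
    show ?thesis
    proof (cases "Y' = {}")
      case True
      then show ?thesis using sum C(1) by simp
    next
      case False
      then obtain u where u: "u \<in> Y'" by blast
      \<comment> \<open>The index \<open>i\<close> has an edge into both components, hence they
        coincide: only one block contributes to the sum for \<open>i\<close>.\<close>
      have K: "K t = K u" if t: "t \<in> Y'" for t
      proof -
        obtain t1 u1 where "(t, t1) \<in> G\<^sup>*" "E i t1" "(u, u1) \<in> G\<^sup>*" "E i u1"
          using t u by (auto simp: Y'_def J_def K_def)
        then have "(t, t1) \<in> G\<^sup>*" "(t1, u1) \<in> G" "(u1, u) \<in> G\<^sup>*" using symG by (auto simp: G_def)
        then show ?thesis by (intro K_eq) (meson rtrancl_into_rtrancl rtrancl_trans)
      qed
      have "Y' \<subseteq> K u" using K tK by blast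
      moreover have "finite Y'" "i \<in> J u" "u \<in> S" using Y u by (auto simp: Y'_def)
      ultimately have "(\<Sum>t\<in>Y'. \<bar>b (K u) i t\<bar>) \<le> C" using b by blast
      also have "(\<Sum>t\<in>Y'. \<bar>b (K u) i t\<bar>) = (\<Sum>t\<in>Y'. \<bar>b (K t) i t\<bar>)"
        using K by (intro sum.cong) auto
      finally show ?thesis using sum by simp
    qed
  qed
  show ?thesis
    unfolding type_c0l1_def
    by (rule exI[of _ "\<lambda>i t. F i t - B i t"], rule exI[of _ B]) (use null_part sum_part in \<open>auto intro!: exI[of _ C]\<close>)
qed

end

section \<open>Covering the points where the family is not null\<close>

theorem theorem3p7:
  assumes "compact (UNIV :: 'a::linorder_topology set)"
    and "\<exists>\<A>. countable \<A> \<and> (\<forall>A\<in>\<A>. finite_two_sided_height (A :: 'a set)) \<and>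
           {t::'a. internal_pt t \<and> countable_right_char t \<and> \<not> separable_adjacency t} \<subseteq> \<Union>\<A>"
  shows "separably_determined TYPE('i) TYPE('a)"
  unfolding separably_determined_def
proof (intro allI impI)
  fix I :: "'i set" and F :: "'i \<Rightarrow> 'a \<Rightarrow> real" and Q :: "'a set"
  assume "weak_star_null I F"
    and H: "\<forall>H. closed H \<and> separable_set H \<longrightarrow>
      countable {t \<in> Q \<inter> (H - right_isolated_in H). \<not> c0_family I (\<lambda>i. F i t)}"
  then obtain M1 M2 where M: "\<forall>i\<in>I. finite_radon (M1 i) \<and> finite_radon (M2 i) \<and>
      (\<forall>t. F i t = measure (M1 i) {..t} - measure (M2 i) {..t})"
    "\<forall>f::'a \<Rightarrow> real. continuous_on UNIV f \<longrightarrow>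
      c0_family I (\<lambda>i. integral\<^sup>L (M1 i) f - integral\<^sup>L (M2 i) f)"
    unfolding weak_star_null_def by (elim exE conjE) (rule that)
  interpret weak_star_null_family I M1 M2 F
    by unfold_locales (use assms(1) M in auto)
  obtain \<A> :: "'a set set" where A: "countable \<A>" "\<And>A. A \<in> \<A> \<Longrightarrow> finite_two_sided_height A"
    "{t. internal_pt t \<and> countable_right_char t \<and> \<not> separable_adjacency t} \<subseteq> \<Union>\<A>"
    using assms(2) by auto
  define T where "T = {t \<in> Q. \<not> c0_family I (\<lambda>i. F i t)}"
  have T: "countable_right_char t" "\<not> right_isolated t" if "t \<in> T" for t
    using that right_isolated_c0 uncountable_right_char_c0 by (auto simp: T_def)
  have sep: "countable {t \<in> T. w \<le> t \<and> t < y}" if "separable_set {w..y}" for w y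
  proof (rule countable_subset)
    show "{t \<in> T. w \<le> t \<and> t < y} \<subseteq>
        {t \<in> Q \<inter> ({w..y} - right_isolated_in {w..y}). \<not> c0_family I (\<lambda>i. F i t)}"
      using T(2) right_isolated_in_interval by (fastforce simp: T_def)
    show "countable {t \<in> Q \<inter> ({w..y} - right_isolated_in {w..y}). \<not> c0_family I (\<lambda>i. F i t)}"
      using H that closed_atLeastAtMost by blast
  qed
  \<comment> \<open>With a separable adjacency, \<open>t\<close> is in \<open>?N\<close> or
    \<open>?X\<close>, as its class does or does not continue above it. Without one, it is
    left-isolated or internal and in some member of the given cover.\<close>
  let ?L = "{t \<in> T. left_isolated t}"
    and ?N = "{t \<in> T. \<exists>s>t. sep_equiv t s}"
    and ?X = "{t \<in> T. (\<exists>u<t. sep_equiv t u) \<and> (\<forall>s>t. \<not> sep_equiv t s)}"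
    and ?I = "\<lambda>A. {t \<in> T \<inter> A. internal_pt t}"
  have "tame ?L" by (rule tame_left_isolated) simp
  moreover have "tame ?N"
  proof (rule tame_sep_equiv)
    fix w y :: 'a assume "separable_set {w..y}"
    from sep[OF this] show "countable {t \<in> ?N. w \<le> t \<and> t < y}"
      by (rule countable_subset[rotated]) auto
  qed simp
  moreover have "tame ?X" by (rule tame_sep_equiv_maximal) auto
  moreover have "tame (\<Union>A\<in>\<A>. ?I A)"
    using A(1,2) by (intro tame_UN tame_finite_height) auto
  ultimately have "tame ((?L \<union> ?N) \<union> (?X \<union> (\<Union>A\<in>\<A>. ?I A)))" by (intro tame_Un)
  moreover have "T \<subseteq> (?L \<union> ?N) \<union> (?X \<union> (\<Union>A\<in>\<A>. ?I A))"
  proof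
    fix t assume t: "t \<in> T"
    show "t \<in> (?L \<union> ?N) \<union> (?X \<union> (\<Union>A\<in>\<A>. ?I A))"
    proof (cases "separable_adjacency t")
      case True
      then obtain u where "u \<noteq> t" "sep_equiv t u" using separable_adjacency_sep_equiv by blast
      then have "t < u \<or> u < t" by auto
      with \<open>sep_equiv t u\<close> have "t \<in> ?N \<union> ?X" using t by blast
      then show ?thesis by blast
    next
      case False
      show ?thesis
      proof (cases "left_isolated t")
        case True
        then show ?thesis using t by blast
      next
        case nl: False
        then have "internal_pt t" using T(2)[OF t] by (simp add: internal_pt_def)
        moreover from this obtain A where "A \<in> \<A>" "t \<in> A" using A(3) T(1)[OF t] False by blast
        ultimately show ?thesis using t by blast
      qed
    qed
  qed
  ultimately have "tame T" by (rule tame_subset)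
  then have "type_c0l1 I F T" using T by (rule tame_imp_type_c0l1)
  then obtain a b C where ab: "\<forall>i\<in>I. \<forall>t\<in>T. F i t = a i t + b i t"
    "\<forall>t\<in>T. c0_family I (\<lambda>i. a i t)"
    "\<forall>i\<in>I. \<forall>Y. Y \<subseteq> T \<and> finite Y \<longrightarrow> (\<Sum>t\<in>Y. \<bar>b i t\<bar>) \<le> C"
    unfolding type_c0l1_def by (elim exE conjE) (rule that)
  show "type_c0l1 I F Q"
    unfolding type_c0l1_def
  \<comment> \<open>Off \<open>T\<close> the family is null already, so there the summable part is
    \<open>0\<close>.\<close>
  proof (rule exI[of _ "\<lambda>i t. if t \<in> T then a i t else F i t"],
      rule exI[of _ "\<lambda>i t. if t \<in> T then b i t else 0"], intro exI[of _ C] conjI ballI allI impI)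
    fix t assume "t \<in> Q"
    then show "c0_family I (\<lambda>i. if t \<in> T then a i t else F i t)"
      using ab(2) by (cases "t \<in> T") (auto simp: T_def)
  next
    fix i Y assume i: "i \<in> I" and Y: "Y \<subseteq> Q \<and> finite Y"
    have "(\<Sum>t\<in>Y. \<bar>if t \<in> T then b i t else 0\<bar>) = (\<Sum>t\<in>Y \<inter> T. \<bar>b i t\<bar>)"
      using Y by (intro sum.mono_neutral_cong_right) auto
    also have "\<dots> \<le> C" using ab(3) i Y by auto
    finally show "(\<Sum>t\<in>Y. \<bar>if t \<in> T then b i t else 0\<bar>) \<le> C" .
  qed (use ab(1) in auto)
qed

end
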